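(* Let $X$ be a metric space and $m\in\mathbb N=\{0,1,2,\dots\}$ with $\dim_{\mathrm A}^{\sigma}X\le m$. Then there is a compact set $Z\subseteq\mathbb R^m$ such that $\dim_{\mathrm P}(X\times Z)=\vec{\dim}_{\mathrm P}X+\dim_{\mathrm P}Z$, where $X\times Z$ carries the maximum metric.
   Context: For a subset $E$ of a metric space $(X,d)$ let $\operatorname{gap}F=\inf\{d(x,y):x,y\in F,x\ne y\}$ for $F\subseteq X$ and $C_r(E)=\sup\{|F|:F\subseteq E,\ \operatorname{gap}F>r\}$. For $Q\ge0$, $m\ge0$, a metric space $X$ is $(Q,m)$-homogeneous if $C_r(E)\le Q(\operatorname{diam}E/r)^m$ for every $E\subseteq X$ and every $0<r\le\operatorname{diam}E$; it is $m$-homogeneous if it is $(Q,m)$-homogeneous for some $Q$. The Assouad dimension is $\dim_{\mathrm A}X=\inf\{m>0: X\text{ is }m\text{-homogeneous}\}$ and $\dim_{\mathrm A}^{\sigma}X=\inf\{\sup_i\dim_{\mathrm A}X_i:\{X_i\}\text{ a countable cover of }X\}$. $N_\delta(E)$ is the minimal cardinality of a cover of $E$ by sets of diameter at most $\delta$; $\underline{\dim}_{\mathrm B}E=\liminf_{\delta\to0}\frac{\log N_\delta(E)}{|\log\delta|}$, $\overline{\dim}_{\mathrm B}E=\limsup_{\delta\to0}\frac{\log N_\delta(E)}{|\log\delta|}$; $\dim_{\mathrm P}E=\inf\{\sup_n\overline{\dim}_{\mathrm B}E_n:E\subseteq\bigcup_nE_n\}$ (countable covers); $\vec{\dim}_{\mathrm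 P}E=\inf\{\sup_n\underline{\dim}_{\mathrm B}E_n:E_n\uparrow E\}$, where $E_n\uparrow E$ means $(E_n)$ is an increasing sequence with union $E$. *)

theory Defs
  imports "HOL-Analysis.Analysis" "HOL-Library.Liminf_Limsup"
begin

definition gap :: "('a \<Rightarrow> 'a \<Rightarrow> real) \<Rightarrow> 'a set \<Rightarrow> ereal" where
  "gap d F = (INF p \<in> {(x,y). x \<in> F \<and> y \<in> F \<and> x \<noteq> y}. ereal (d (fst p) (snd p)))"

definition ecard :: "'a set \<Rightarrow> ereal" where
  "ecard F = (if finite F then ereal (real (card F)) else \<infinity>)"

definition Cr :: "('a \<Rightarrow> 'a \<Rightarrow> real) \<Rightarrow> real \<Rightarrow> 'a set \<Rightarrow> ereal" where
  "Cr d r E = (SUP F \<in> {F. F \<subseteq> E \<and> gap d F > ereal r}. ecard F)"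

definition ediam :: "('a \<Rightarrow> 'a \<Rightarrow> real) \<Rightarrow> 'a set \<Rightarrow> ereal" where
  "ediam d E = (SUP p \<in> E \<times> E. ereal (d (fst p) (snd p)))"

text \<open>(Q,m)-homogeneity. For unbounded E (diam E = \<infinity>) the right-hand side is \<infinity> (m > 0),
  so only bounded E impose a condition.\<close>
definition homogeneous :: "'a set \<Rightarrow> ('a \<Rightarrow> 'a \<Rightarrow> real) \<Rightarrow> real \<Rightarrow> real \<Rightarrow> bool" where
  "homogeneous X d Q m \<longleftrightarrow> Q \<ge> 0 \<and> m \<ge> 0 \<and>
     (\<forall>E \<subseteq> X. ediam d E < \<infinity> \<longrightarrow>
        (\<forall>r. 0 < r \<and> ereal r \<le> ediam d E \<longrightarrow>
             Cr d r E \<le> ereal (Q * (real_of_ereal (ediam d E) / r) powr m)))"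

definition m_homogeneous :: "'a set \<Rightarrow> ('a \<Rightarrow> 'a \<Rightarrow> real) \<Rightarrow> real \<Rightarrow> bool" where
  "m_homogeneous X d m \<longleftrightarrow> (\<exists>Q. homogeneous X d Q m)"

definition assouad_dim :: "'a set \<Rightarrow> ('a \<Rightarrow> 'a \<Rightarrow> real) \<Rightarrow> ereal" where
  "assouad_dim X d = Inf {ereal m | m. m > 0 \<and> m_homogeneous X d m}"

definition sigma_assouad_dim :: "'a set \<Rightarrow> ('a \<Rightarrow> 'a \<Rightarrow> real) \<Rightarrow> ereal" where
  "sigma_assouad_dim X d =
     Inf {(SUP i. assouad_dim (Xs i) d) | Xs :: nat \<Rightarrow> 'a set.
            (\<forall>i. Xs i \<subseteq> X) \<and> X \<subseteq> (\<Union>i. Xs i)}"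

definition covnum :: "'a set \<Rightarrow> ('a \<Rightarrow> 'a \<Rightarrow> real) \<Rightarrow> real \<Rightarrow> 'a set \<Rightarrow> ereal" where
  "covnum X d \<delta> E = Inf {ereal (real (card C)) | C. finite C \<and>
       (\<forall>F \<in> C. F \<subseteq> X \<and> ediam d F \<le> ereal \<delta>) \<and> E \<subseteq> \<Union>C}"

definition box_ratio :: "'a set \<Rightarrow> ('a \<Rightarrow> 'a \<Rightarrow> real) \<Rightarrow> 'a set \<Rightarrow> real \<Rightarrow> ereal" where
  "box_ratio X d E \<delta> = (if covnum X d \<delta> E = \<infinity> then \<infinity>
     else ereal (ln (real_of_ereal (covnum X d \<delta> E)) / \<bar>ln \<delta>\<bar>))"

definition lower_box_dim :: "'a set \<Rightarrow> ('a \<Rightarrow> 'a \<Rightarrow> real) \<Rightarrow> 'a set \<Rightarrow> ereal" where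
  "lower_box_dim X d E = Liminf (at_right (0::real)) (box_ratio X d E)"

definition upper_box_dim :: "'a set \<Rightarrow> ('a \<Rightarrow> 'a \<Rightarrow> real) \<Rightarrow> 'a set \<Rightarrow> ereal" where
  "upper_box_dim X d E = Limsup (at_right (0::real)) (box_ratio X d E)"

definition packing_dim :: "'a set \<Rightarrow> ('a \<Rightarrow> 'a \<Rightarrow> real) \<Rightarrow> 'a set \<Rightarrow> ereal" where
  "packing_dim X d E = Inf {(SUP n. upper_box_dim X d (Es n)) | Es :: nat \<Rightarrow> 'a set.
       (\<forall>n. Es n \<subseteq> X) \<and> E \<subseteq> (\<Union>n. Es n)}"

definition inc_packing_dim :: "'a set \<Rightarrow> ('a \<Rightarrow> 'a \<Rightarrow> real) \<Rightarrow> 'a set \<Rightarrow> ereal" where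
  "inc_packing_dim X d E = Inf {(SUP n. lower_box_dim X d (Es n)) | Es :: nat \<Rightarrow> 'a set.
       incseq Es \<and> (\<Union>n. Es n) = E}"

definition max_metric :: "('a \<Rightarrow> 'a \<Rightarrow> real) \<Rightarrow> ('b \<Rightarrow> 'b \<Rightarrow> real) \<Rightarrow> 'a \<times> 'b \<Rightarrow> 'a \<times> 'b \<Rightarrow> real" where
  "max_metric d1 d2 p q = max (d1 (fst p) (fst q)) (d2 (snd p) (snd q))"

text \<open>R^m (m may be 0) realised as functions nat \<Rightarrow> real vanishing from index m on,
  with the Euclidean metric.\<close>
definition Rm :: "nat \<Rightarrow> (nat \<Rightarrow> real) set" where
  "Rm m = {x. \<forall>i \<ge> m. x i = 0}"

definition eucl :: "nat \<Rightarrow> (nat \<Rightarrow> real) \<Rightarrow> (nat \<Rightarrow> real) \<Rightarrow> real" where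
  "eucl m x y = sqrt (\<Sum>i<m. (x i - y i)\<^sup>2)"

end

theory Submission
  imports Defs "HOL-Real_Asymp.Real_Asymp"
begin

text \<open>Let \<open>s\<close> be the increasing packing dimension of \<open>X\<close>. For \<open>\<sigma> > s\<close>
  there are \<open>E\<^sub>n \<up> X\<close> and one sequence of scales \<open>2\<^sup>-\<^sup>l\<close> along which every \<open>E\<^sub>n\<close> is covered by
  \<open>O(2 powr (\<sigma> l))\<close> sets. A Cantor set of points of \<open>\<real>\<^sup>m\<close> whose binary digits are free
  exactly at suitable positions has about \<open>2 powr ((m - \<sigma>) l)\<close> pieces at these scales, while at every scale
  the covering numbers of \<open>E\<^sub>n\<close> and of the Cantor set multiply to at most \<open>2 powr (m N)\<close>; here the
  Assouad dimension limits the growth of \<open>E\<^sub>n\<close> between good scales. The union of these Cantor sets for \<open>\<sigma>\<close>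
  decreasing to \<open>s\<close>, shrunk towards the origin, is a compact \<open>Z\<close> of packing dimension \<open>m - s\<close>
  with \<open>dim\<^sub>P (X \<times> Z) \<le> m\<close>. For the converse inequality, by Baire category a countable cover of \<open>X \<times> Z\<close>
  contains pieces that are dense in whole cylinders \<open>{x} \<times> C\<close>, and counting at the good scales of the
  Cantor set, which are the same for all cylinders, bounds the lower box dimensions of an
  increasing sequence exhausting \<open>X\<close>.\<close>

section \<open>Covering numbers and box dimensions\<close>

text \<open>In contrast to \<open>covnum\<close>, the pieces need not lie in an ambient space and
  the bound \<open>M\<close> is any real number, so that covers can be restricted, united and
  multiplied with explicit constants.\<close>

definition covers_by :: "('a \<Rightarrow> 'a \<Rightarrow> real) \<Rightarrow> real \<Rightarrow> 'a set \<Rightarrow> real \<Rightarrow> bool" where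
  "covers_by d \<delta> E M \<longleftrightarrow> (\<exists>C. finite C \<and> (\<forall>F\<in>C. \<forall>x\<in>F. \<forall>y\<in>F. d x y \<le> \<delta>) \<and>
     E \<subseteq> \<Union>C \<and> real (card C) \<le> M)"

lemma covers_by_mono:
  assumes "covers_by d \<delta> E M" "\<delta> \<le> \<delta>'" "M \<le> M'" "E' \<subseteq> E"
  shows "covers_by d \<delta>' E' M'"
proof -
  obtain C where "finite C" "\<forall>F\<in>C. \<forall>x\<in>F. \<forall>y\<in>F. d x y \<le> \<delta>" "E \<subseteq> \<Union>C" "real (card C) \<le> M"
    using assms(1) unfolding covers_by_def by blast
  then show ?thesis
    unfolding covers_by_def using assms(2-4) by (intro exI[of _ C]) (force intro: order_trans)
qed

lemma covers_by_ge_1: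
  assumes "covers_by d \<delta> E M" "E \<noteq> {}"
  shows "1 \<le> M"
proof -
  obtain C where C: "finite C" "E \<subseteq> \<Union>C" "real (card C) \<le> M"
    using assms(1) unfolding covers_by_def by blast
  then have "card C \<noteq> 0" using assms(2) by auto
  then have "1 \<le> real (card C)" by simp
  then show ?thesis using C by linarith
qed

lemma covers_by_UN:
  assumes "finite I" "\<And>i. i \<in> I \<Longrightarrow> covers_by d \<delta> (E i) (M i)"
  shows "covers_by d \<delta> (\<Union>i\<in>I. E i) (\<Sum>i\<in>I. M i)"
proof -
  have "\<forall>i\<in>I. \<exists>C. finite C \<and> (\<forall>F\<in>C. \<forall>x\<in>F. \<forall>y\<in>F. d x y \<le> \<delta>) \<and>
     E i \<subseteq> \<Union>C \<and> real (card C) \<le> M i"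
    using assms(2) unfolding covers_by_def by blast
  then obtain C where C: "\<And>i. i \<in> I \<Longrightarrow> finite (C i)"
      "\<And>i. i \<in> I \<Longrightarrow> \<forall>F\<in>C i. \<forall>x\<in>F. \<forall>y\<in>F. d x y \<le> \<delta>"
      "\<And>i. i \<in> I \<Longrightarrow> E i \<subseteq> \<Union>(C i)" "\<And>i. i \<in> I \<Longrightarrow> real (card (C i)) \<le> M i"
    by metis
  have "real (card (\<Union>i\<in>I. C i)) \<le> real (\<Sum>i\<in>I. card (C i))"
    using card_UN_le[OF assms(1)] of_nat_le_iff by blast
  also have "\<dots> \<le> (\<Sum>i\<in>I. M i)" using C(4) by (simp add: sum_mono)
  finally have "real (card (\<Union>i\<in>I. C i)) \<le> (\<Sum>i\<in>I. M i)" .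
  moreover have "finite (\<Union>i\<in>I. C i)" using C(1) assms(1) by blast
  moreover have "\<forall>F\<in>(\<Union>i\<in>I. C i). \<forall>x\<in>F. \<forall>y\<in>F. d x y \<le> \<delta>" using C(2) by blast
  moreover have "(\<Union>i\<in>I. E i) \<subseteq> \<Union>(\<Union>i\<in>I. C i)" using C(3) by blast
  ultimately show ?thesis unfolding covers_by_def by blast
qed

lemma covers_by_Times:
  assumes "covers_by d \<delta> E M" "covers_by e \<delta> F N"
  shows "covers_by (max_metric d e) \<delta> (E \<times> F) (M * N)"
proof -
  obtain C where C: "finite C" "\<forall>F\<in>C. \<forall>x\<in>F. \<forall>y\<in>F. d x y \<le> \<delta>" "E \<subseteq> \<Union>C" "real (card C) \<le> M"
    using assms(1) unfolding covers_by_def by blast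
  obtain D where D: "finite D" "\<forall>F\<in>D. \<forall>x\<in>F. \<forall>y\<in>F. e x y \<le> \<delta>" "F \<subseteq> \<Union>D" "real (card D) \<le> N"
    using assms(2) unfolding covers_by_def by blast
  let ?P = "(\<lambda>(a,b). a \<times> b) ` (C \<times> D)"
  have "card ?P \<le> card C * card D"
    using card_image_le[of "C \<times> D"] C D by (simp add: card_cartesian_product)
  then have "real (card ?P) \<le> real (card C) * real (card D)"
    by (metis of_nat_le_iff of_nat_mult)
  also have "\<dots> \<le> M * N" using C(4) D(4) by (intro mult_mono) auto
  finally have "real (card ?P) \<le> M * N" .
  moreover have "E \<times> F \<subseteq> \<Union>?P" using C(3) D(3) by fastforce
  moreover have "\<forall>G\<in>?P. \<forall>x\<in>G. \<forall>y\<in>G. max_metric d e x y \<le> \<delta>"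
    using C(2) D(2) by (auto simp: max_metric_def)
  ultimately show ?thesis unfolding covers_by_def using C(1) D(1) by (intro exI[of _ ?P]) auto
qed

lemma ediam_le_iff: "ediam d F \<le> ereal \<delta> \<longleftrightarrow> (\<forall>x\<in>F. \<forall>y\<in>F. d x y \<le> \<delta>)"
  unfolding ediam_def by (auto simp: SUP_le_iff)

lemma covnum_le:
  assumes "covers_by d \<delta> E M" "E \<subseteq> X"
  shows "covnum X d \<delta> E \<le> ereal M"
proof -
  obtain C where C: "finite C" "\<forall>F\<in>C. \<forall>x\<in>F. \<forall>y\<in>F. d x y \<le> \<delta>" "E \<subseteq> \<Union>C" "real (card C) \<le> M"
    using assms(1) unfolding covers_by_def by blast
  \<comment> \<open>\<open>covnum\<close> admits only subsets of \<open>X\<close>, so the pieces are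
    cut down to \<open>X\<close>.\<close>
  let ?C = "(\<lambda>F. F \<inter> X) ` C"
  have "covnum X d \<delta> E \<le> ereal (real (card ?C))"
    unfolding covnum_def
  proof (rule Inf_lower, clarsimp, intro exI[of _ ?C] conjI refl)
    show "finite ?C" using C by auto
    show "\<forall>F\<in>?C. F \<subseteq> X \<and> ediam d F \<le> ereal \<delta>" using C(2) unfolding ediam_le_iff by auto
    show "E \<subseteq> \<Union>?C" using C(3) assms(2) by fastforce
  qed
  also have "\<dots> \<le> ereal (real (card C))" using card_image_le[OF C(1)] by simp
  also have "\<dots> \<le> ereal M" using C by simp
  finally show ?thesis .
qed

text \<open>Cardinalities of finite covers are natural numbers, so a finite infimum is a minimum;
  without any finite cover it is the infimum of the empty set, which is \<infinity>.\<close>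

lemma covnum_attained:
  assumes "covnum X d \<delta> E \<noteq> \<infinity>"
  obtains n where "covnum X d \<delta> E = ereal (real n)" "covers_by d \<delta> E (real n)"
proof -
  define P where "P n \<longleftrightarrow> (\<exists>C. finite C \<and> (\<forall>F \<in> C. F \<subseteq> X \<and> ediam d F \<le> ereal \<delta>) \<and> E \<subseteq> \<Union>C \<and> card C = n)" for n
  have eq: "covnum X d \<delta> E = Inf {ereal (real n) | n. P n}"
    unfolding covnum_def P_def by (rule arg_cong[where f=Inf]) auto
  have "\<exists>n. P n"
  proof (rule ccontr)
    assume "\<nexists>n. P n"
    then have "{ereal (real n) | n. P n} = {}" by auto
    with eq have "covnum X d \<delta> E = Inf {}" by metis
    with assms show False by (simp add: top_ereal_def)
  qed
  then have P: "P (LEAST n. P n)" by (meson LeastI_ex)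
  have "covnum X d \<delta> E = ereal (real (LEAST n. P n))"
    unfolding eq by (rule Inf_eqI) (use P in \<open>auto intro: Least_le\<close>)
  moreover have "covers_by d \<delta> E (real (LEAST n. P n))"
    using P unfolding P_def covers_by_def ediam_le_iff by fastforce
  ultimately show ?thesis using that by blast
qed

lemma box_ratio_nonneg: "0 \<le> box_ratio X d E \<delta>"
proof (cases "covnum X d \<delta> E = \<infinity>")
  case False
  then obtain n where n: "covnum X d \<delta> E = ereal (real n)" by (rule covnum_attained)
  \<comment> \<open>Covering number 0 occurs for the empty set; there \<open>ln 0 = 0\<close> by
    convention.\<close>
  have "0 \<le> ln (real n)" by (cases "n = 0") auto
  then show ?thesis using n by (simp add: box_ratio_def)
qed (simp add: box_ratio_def)

lemma box_ratio_le:
  assumes "covers_by d \<delta> E M" "E \<subseteq> X" "1 \<le> M"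
  shows "box_ratio X d E \<delta> \<le> ereal (ln M / \<bar>ln \<delta>\<bar>)"
proof -
  have le: "covnum X d \<delta> E \<le> ereal M" using covnum_le[OF assms(1,2)] .
  then have "covnum X d \<delta> E \<noteq> \<infinity>" by auto
  then obtain n where n: "covnum X d \<delta> E = ereal (real n)" by (rule covnum_attained)
  have "ln (real n) \<le> ln M"
    using le assms(3) unfolding n by (cases "n = 0") auto
  then show ?thesis using n by (simp add: box_ratio_def divide_right_mono)
qed

lemma covers_by_of_box_ratio_less:
  assumes "box_ratio X d E \<delta> < ereal t" "0 < \<delta>" "\<delta> < 1"
  shows "covers_by d \<delta> E ((1 / \<delta>) powr t)"
proof -
  have "covnum X d \<delta> E \<noteq> \<infinity>" using assms(1) by (auto simp: box_ratio_def)
  then obtain n where n: "covnum X d \<delta> E = ereal (real n)" "covers_by d \<delta> E (real n)"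
    by (rule covnum_attained)
  have "ln (real n) / \<bar>ln \<delta>\<bar> < t" using assms(1) n by (simp add: box_ratio_def)
  moreover have "\<bar>ln \<delta>\<bar> = ln (1 / \<delta>)" "ln (1 / \<delta>) > 0" using assms by (auto simp: ln_div)
  ultimately have l: "ln (real n) < t * ln (1 / \<delta>)" by (simp add: field_simps)
  have "real n \<le> (1 / \<delta>) powr t"
  proof (cases "n = 0")
    case False
    then have "real n = exp (ln (real n))" by simp
    also have "\<dots> \<le> exp (t * ln (1 / \<delta>))" using l by simp
    also have "\<dots> = (1 / \<delta>) powr t" using assms by (simp add: powr_def)
    finally show ?thesis .
  qed auto
  then show ?thesis using covers_by_mono[OF n(2)] by auto
qed

lemma upper_box_dim_nonneg: "0 \<le> upper_box_dim X d E"
  unfolding upper_box_dim_def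
  by (rule le_Limsup) (auto simp: box_ratio_nonneg trivial_limit_at_right_real)

lemma lower_box_dim_nonneg: "0 \<le> lower_box_dim X d E"
  unfolding lower_box_dim_def by (rule Liminf_bounded) (auto simp: box_ratio_nonneg)

lemma inc_packing_dim_nonneg: "0 \<le> inc_packing_dim X d E"
  unfolding inc_packing_dim_def
  by (rule Inf_greatest) (auto intro: SUP_upper2 lower_box_dim_nonneg)

text \<open>A lower limit needs control only along infinitely many of the scales
  \<open>c / 2 ^ N\<close>; after division by \<open>\<bar>ln \<delta>\<bar>\<close> the constants
  \<open>c\<close> and \<open>K\<close> disappear in the limit.\<close>

lemma lower_box_dim_le:
  assumes cov: "\<exists>\<^sub>F N in sequentially. covers_by d (c / 2 ^ N) E (K * 2 powr (u * real N))"
    and "0 < c" "1 \<le> K" "0 \<le> u" "E \<subseteq> X"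
  shows "lower_box_dim X d E \<le> ereal u"
proof (rule ccontr)
  assume "\<not> ?thesis"
  then obtain v where v: "ereal u < ereal v" "ereal v < lower_box_dim X d E"
    using ereal_dense2 by (meson linorder_not_le)
  then have ev: "\<forall>\<^sub>F \<delta> in at_right 0. ereal v < box_ratio X d E \<delta>"
    unfolding lower_box_dim_def by (intro less_LiminfD) auto
  have lim: "filterlim (\<lambda>N. c / 2 ^ N) (at_right 0) sequentially"
    using assms(2) by real_asymp
  have ev1: "\<forall>\<^sub>F N in sequentially. ereal v < box_ratio X d E (c / 2 ^ N)"
    using ev lim by (rule eventually_compose_filterlim)
  have "((\<lambda>N. (ln K + u * real N * ln 2) / \<bar>ln c - real N * ln 2\<bar>) \<longlongrightarrow> u) sequentially"
    by real_asymp
  then have ev2: "\<forall>\<^sub>F N in sequentially. (ln K + u * real N * ln 2) / \<bar>ln c - real N * ln 2\<bar> < v"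
    using v by (auto dest: order_tendstoD)
  obtain N where N: "covers_by d (c / 2 ^ N) E (K * 2 powr (u * real N))"
      "ereal v < box_ratio X d E (c / 2 ^ N)"
      "(ln K + u * real N * ln 2) / \<bar>ln c - real N * ln 2\<bar> < v"
    using frequently_ex[OF frequently_eventually_conj[OF cov eventually_conj[OF ev1 ev2]]] by auto
  have "1 \<le> K * 2 powr (u * real N)"
    using assms mult_mono[of 1 K 1 "2 powr (u * real N)"] by (simp add: ge_one_powr_ge_zero)
  from box_ratio_le[OF N(1) assms(5) this] N(2)
  have "v < ln (K * 2 powr (u * real N)) / \<bar>ln (c / 2 ^ N)\<bar>"
    by (meson ereal_less_eq(3) less_le_trans linorder_not_le)
  moreover have "ln (K * 2 powr (u * real N)) = ln K + u * real N * ln 2"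
    using assms by (simp add: ln_mult ln_powr)
  moreover have "ln (c / 2 ^ N) = ln c - real N * ln 2"
    using assms by (simp add: ln_div ln_realpow)
  ultimately show False using N(3) by simp
qed

text \<open>For small \<open>\<delta>\<close> the first scale \<open>c / 2 ^ n\<close> not exceeding
  \<open>\<delta>\<close> is finer by less than a factor 2, so passing to it changes the covering
  bound by a bounded factor only.\<close>

lemma upper_box_dim_le:
  assumes cov: "\<forall>\<^sub>F N in sequentially. covers_by d (c / 2 ^ N) E (K * 2 powr (u * real N))"
    and c: "0 < c" and K: "1 \<le> K" and u: "0 \<le> u" and E: "E \<subseteq> X"
  shows "upper_box_dim X d E \<le> ereal u"
  unfolding upper_box_dim_def
proof (subst Limsup_le_iff, intro allI impI)
  fix y assume y: "ereal u < y"
  then obtain v where v: "ereal u < ereal v" "ereal v < y"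
    using ereal_dense2 by blast
  define n where "n \<delta> = nat \<lceil>log 2 (c / \<delta>)\<rceil>" for \<delta>
  have lim: "filterlim n sequentially (at_right 0)"
    unfolding n_def using c by real_asymp
  have ev1: "\<forall>\<^sub>F \<delta> in at_right 0. covers_by d (c / 2 ^ n \<delta>) E (K * 2 powr (u * real (n \<delta>)))"
    using cov lim by (rule eventually_compose_filterlim)
  have "((\<lambda>\<delta>. (ln K + u * (log 2 (c / \<delta>) + 1) * ln 2) / \<bar>ln \<delta>\<bar>) \<longlongrightarrow> u) (at_right 0)"
    using c by real_asymp
  then have ev2: "\<forall>\<^sub>F \<delta> in at_right 0. (ln K + u * (log 2 (c / \<delta>) + 1) * ln 2) / \<bar>ln \<delta>\<bar> < v"
    using v by (auto dest: order_tendstoD)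
  have ev3: "\<forall>\<^sub>F \<delta> in at_right 0. 0 < log 2 (c / \<delta>)" using c by real_asymp
  have ev4: "\<forall>\<^sub>F \<delta> in at_right 0. 0 < (\<delta>::real)" by real_asymp
  show "\<forall>\<^sub>F \<delta> in at_right 0. box_ratio X d E \<delta> < y"
    using ev1 ev2 ev3 ev4
  proof eventually_elim
    case (elim \<delta>)
    have n1: "log 2 (c / \<delta>) \<le> real (n \<delta>)" "real (n \<delta>) \<le> log 2 (c / \<delta>) + 1"
      unfolding n_def using elim(3) by linarith+
    have "c / \<delta> \<le> 2 powr real (n \<delta>)"
      using n1(1) elim(4) c by (simp add: log_le_iff)
    then have "c / 2 ^ n \<delta> \<le> \<delta>" using elim(4) by (simp add: powr_realpow field_simps)
    then have "covers_by d \<delta> E (K * 2 powr (u * real (n \<delta>)))"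
      using covers_by_mono[OF elim(1)] by auto
    moreover have "1 \<le> K * 2 powr (u * real (n \<delta>))"
      using K u mult_mono[of 1 K 1 "2 powr (u * real (n \<delta>))"] by (simp add: ge_one_powr_ge_zero)
    ultimately have "box_ratio X d E \<delta> \<le> ereal (ln (K * 2 powr (u * real (n \<delta>))) / \<bar>ln \<delta>\<bar>)"
      using box_ratio_le E by metis
    also have "ln (K * 2 powr (u * real (n \<delta>))) = ln K + u * real (n \<delta>) * ln 2"
      using K by (simp add: ln_mult ln_powr)
    also have "\<dots> \<le> ln K + u * (log 2 (c / \<delta>) + 1) * ln 2"
      using n1 u by (auto intro!: mult_left_mono mult_right_mono)
    finally have "box_ratio X d E \<delta> \<le> ereal ((ln K + u * (log 2 (c / \<delta>) + 1) * ln 2) / \<bar>ln \<delta>\<bar>)"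
      by (simp add: divide_right_mono)
    also have "\<dots> < ereal v" using elim by simp
    finally show ?case using v by simp
  qed
qed

lemma covers_by_of_upper_box_dim_less:
  assumes "upper_box_dim X d E < ereal t"
  shows "\<forall>\<^sub>F N in sequentially. covers_by d (1 / 2 ^ N) E (2 powr (t * real N))"
proof -
  have "\<forall>\<^sub>F \<delta> in at_right 0. box_ratio X d E \<delta> < ereal t"
    using assms unfolding upper_box_dim_def by (rule Limsup_lessD)
  moreover have "filterlim (\<lambda>N::nat. 1 / 2 ^ N :: real) (at_right 0) sequentially" by real_asymp
  ultimately have "\<forall>\<^sub>F N in sequentially. box_ratio X d E (1 / 2 ^ N) < ereal t"
    by (rule eventually_compose_filterlim)
  then show ?thesis using eventually_gt_at_top[of 0]
  proof eventually_elim
    case (elim N)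
    have "covers_by d (1 / 2 ^ N) E ((1 / (1 / 2 ^ N)) powr t)"
      using elim by (intro covers_by_of_box_ratio_less) auto
    moreover have "(1 / (1 / 2 ^ N)) powr t = 2 powr (t * real N)"
      by (simp add: powr_powr mult.commute flip: powr_realpow)
    ultimately show ?case by simp
  qed
qed

text \<open>Otherwise the box ratio would be at least \<open>t\<close> on a whole interval to the
  right of 0. A scale \<open>\<delta>\<close> with ratio below \<open>t\<close> is rounded up to the
  next dyadic scale, which is coarser by at most a factor 2; this costs the factor
  \<open>2 powr t\<close>.\<close>

lemma covers_by_of_lower_box_dim_less:
  assumes "lower_box_dim X d E < ereal t" "0 \<le> t"
  shows "\<exists>N\<ge>n. covers_by d (1 / 2 ^ N) E (2 powr t * 2 powr (t * real N))"
proof (rule ccontr)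
  assume neg: "\<not> ?thesis"
  have "ereal t \<le> box_ratio X d E \<delta>" if \<delta>: "0 < \<delta>" "\<delta> < 1 / 2 ^ n" for \<delta>
  proof (rule ccontr)
    assume "\<not> ereal t \<le> box_ratio X d E \<delta>"
    have "(1 / 2 ^ n :: real) \<le> 1" by simp
    then have \<delta>1: "\<delta> < 1" using \<delta> by linarith
    then have cov: "covers_by d \<delta> E ((1 / \<delta>) powr t)"
      using \<open>\<not> ereal t \<le> box_ratio X d E \<delta>\<close> \<delta> by (intro covers_by_of_box_ratio_less[of X]) auto
    define N where "N = nat \<lfloor>log 2 (1 / \<delta>)\<rfloor>"
    have "log 2 (1 / \<delta>) > 0" using \<delta> \<delta>1 by simp
    then have N: "real N \<le> log 2 (1 / \<delta>)" "log 2 (1 / \<delta>) \<le> real N + 1"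
      unfolding N_def by linarith+
    have "2 powr real N \<le> 1 / \<delta>" using N \<delta> by (simp add: le_log_iff)
    then have N1: "\<delta> \<le> 1 / 2 ^ N" using \<delta> by (simp add: powr_realpow field_simps)
    have N2: "1 / \<delta> \<le> 2 powr (real N + 1)" using N \<delta> by (simp add: log_le_iff)
    have "2 powr real n < 1 / \<delta>" using \<delta> by (simp add: powr_realpow field_simps)
    then have "2 powr real n < 2 powr (real N + 1)" using N2 by linarith
    then have "n \<le> N" by simp
    have "(1 / \<delta>) powr t \<le> (2 powr (real N + 1)) powr t"
      using N2 assms(2) \<delta> by (intro powr_mono2) auto
    also have "\<dots> = 2 powr t * 2 powr (t * real N)"
      by (simp add: powr_powr powr_add[symmetric] algebra_simps)
    finally have "covers_by d (1 / 2 ^ N) E (2 powr t * 2 powr (t * real N))"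
      using covers_by_mono[OF cov N1] by auto
    then show False using neg \<open>n \<le> N\<close> by auto
  qed
  then have "\<forall>\<^sub>F \<delta> in at_right 0. ereal t \<le> box_ratio X d E \<delta>"
    unfolding eventually_at_right_field by (intro exI[of _ "1 / 2 ^ n"]) auto
  then have "ereal t \<le> lower_box_dim X d E"
    unfolding lower_box_dim_def by (rule Liminf_bounded)
  then show False using assms by simp
qed

section \<open>Packing dimension and countable covers\<close>

lemma packing_dim_le:
  assumes "countable \<E>" "\<And>E. E \<in> \<E> \<Longrightarrow> E \<subseteq> X" "A \<subseteq> \<Union>\<E>"
    and "\<And>E. E \<in> \<E> \<Longrightarrow> upper_box_dim X d E \<le> t" "0 \<le> t"
  shows "packing_dim X d A \<le> t"
proof (cases "\<E> = {}")
  \<comment> \<open>\<open>packing_dim\<close> ranges over sequences of sets. A nonempty countable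
    family is enumerated by \<open>from_nat_into\<close>; for the empty family the constant sequence
    of empty sets serves instead.\<close>
  case True
  have "upper_box_dim X d {} \<le> ereal 0"
    by (rule upper_box_dim_le[where c=1 and K=1]) (auto simp: covers_by_def intro!: always_eventually exI[of _ "{}"])
  then have "(SUP n::nat. upper_box_dim X d {}) \<le> t" using assms(5) by (auto simp flip: zero_ereal_def)
  moreover have "packing_dim X d A \<le> (SUP n::nat. upper_box_dim X d {})"
    unfolding packing_dim_def using assms(3) True
    by (intro Inf_lower CollectI exI[of _ "\<lambda>_. {}"]) auto
  ultimately show ?thesis by order
next
  case False
  have r: "range (from_nat_into \<E>) = \<E>" using assms(1) False by simp
  then have "packing_dim X d A \<le> (SUP n. upper_box_dim X d (from_nat_into \<E> n))"
    unfolding packing_dim_def using assms(2,3)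
    by (intro Inf_lower CollectI exI[of _ "from_nat_into \<E>"] conjI refl) (metis rangeI, metis)
  also have "\<dots> \<le> t" using r assms(4) by (intro SUP_least) (metis rangeI)
  finally show ?thesis .
qed

lemma packing_dim_less_cover:
  assumes "packing_dim X d (A :: 'a set) < ereal t"
  shows "\<exists>Es :: nat \<Rightarrow> 'a set. A \<subseteq> (\<Union>n. Es n) \<and>
    (\<forall>n. \<forall>\<^sub>F N in sequentially. covers_by d (1 / 2 ^ N) (Es n) (2 powr (t * real N)))"
proof -
  obtain Es :: "nat \<Rightarrow> 'a set" where Es: "A \<subseteq> (\<Union>n. Es n)"
      "(SUP n. upper_box_dim X d (Es n)) < ereal t"
    using assms unfolding packing_dim_def Inf_less_iff by auto
  then have "upper_box_dim X d (Es n) < ereal t" for n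
    by (meson SUP_lessD UNIV_I)
  then show ?thesis using Es(1) covers_by_of_upper_box_dim_less by blast
qed

section \<open>Homogeneity and good scales\<close>

text \<open>A separated subset of greatest cardinality exists because the cardinalities are bounded
  by \<open>M\<close>. It is an \<open>r\<close>-net, since a point farther than \<open>r\<close>
  from it could be added, and the balls of radius \<open>r\<close> around its points form the
  cover.\<close>

lemma covers_by_if_separated_bounded:
  assumes "Metric_space X d" "F \<subseteq> X" "0 \<le> r"
    and bound: "\<And>S. finite S \<Longrightarrow> S \<subseteq> F \<Longrightarrow> (\<And>x y. x \<in> S \<Longrightarrow> y \<in> S \<Longrightarrow> x \<noteq> y \<Longrightarrow> r < d x y) \<Longrightarrow> real (card S) \<le> M"
  shows "covers_by d (2 * r) F M"
proof -
  interpret Metric_space X d by fact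
  define P where "P S \<longleftrightarrow> finite S \<and> S \<subseteq> F \<and> (\<forall>x\<in>S. \<forall>y\<in>S. x \<noteq> y \<longrightarrow> r < d x y)" for S
  have P_bound: "real (card S) \<le> M" if "P S" for S using that unfolding P_def by (intro bound) auto
  have "P {}" unfolding P_def by auto
  moreover have "\<forall>S. P S \<longrightarrow> card S < Suc (nat \<lfloor>M\<rfloor>)"
    using P_bound by (auto simp: le_nat_floor less_Suc_eq_le)
  ultimately obtain S where S: "P S" "\<And>S'. P S' \<Longrightarrow> card S' \<le> card S"
    using ex_has_greatest_nat[of P "{}" card] by blast
  let ?C = "(\<lambda>s. {y\<in>F. d s y \<le> r}) ` S"
  have "\<exists>s\<in>S. d s x \<le> r" if x: "x \<in> F" for x
  proof (rule ccontr)
    assume far: "\<not> ?thesis"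
    have "x \<notin> S" using far x assms(2,3) mdist_zero by force
    have "P (insert x S)" using S(1) far x commute unfolding P_def by (auto simp: not_le)
    from S(2)[OF this] show False using \<open>x \<notin> S\<close> S(1) unfolding P_def by simp
  qed
  then have "F \<subseteq> \<Union>?C" by auto
  moreover have "\<forall>G\<in>?C. \<forall>x\<in>G. \<forall>y\<in>G. d x y \<le> 2 * r"
  proof clarify
    fix s x y assume *: "s \<in> S" "x \<in> F" "d s x \<le> r" "y \<in> F" "d s y \<le> r"
    then have "s \<in> X" "x \<in> X" "y \<in> X" using S(1) assms(2) unfolding P_def by auto
    then have "d x y \<le> d s x + d s y" using triangle[of x s y] commute[of x s] by simp
    then show "d x y \<le> 2 * r" using * by simp
  qed
  moreover have "real (card ?C) \<le> M"
    using P_bound[OF S(1)] card_image_le[of S] S(1) unfolding P_def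
    by (meson of_nat_le_iff order_trans)
  ultimately show ?thesis unfolding covers_by_def using S(1) P_def by (intro exI[of _ ?C]) auto
qed

text \<open>For a finite set the infimum over pairs is a minimum, which keeps the inequality strict;
  with fewer than two points it is the infimum of the empty set, \<infinity>.\<close>

lemma gap_gt_if_finite:
  assumes "finite S" "\<And>x y. x \<in> S \<Longrightarrow> y \<in> S \<Longrightarrow> x \<noteq> y \<Longrightarrow> r < d x y"
  shows "ereal r < gap d S"
proof (cases "{(x,y). x \<in> S \<and> y \<in> S \<and> x \<noteq> y} = {}")
  case True
  then show ?thesis unfolding gap_def by (simp only:) (simp add: top_ereal_def)
next
  case False
  let ?P = "{(x,y). x \<in> S \<and> y \<in> S \<and> x \<noteq> y}"
  let ?I = "(\<lambda>p. ereal (d (fst p) (snd p))) ` ?P"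
  have "finite ?P" by (rule finite_subset[of _ "S \<times> S"]) (use assms(1) in auto)
  then have "finite ?I" "?I \<noteq> {}" using False by blast+
  then have "Inf ?I \<in> ?I" using Min_in[of ?I] Min_Inf[of ?I] by metis
  then show ?thesis unfolding gap_def using assms(2) by auto
qed

lemma homogeneous_covers_by:
  assumes "Metric_space X d" "Y \<subseteq> X" and hom: "homogeneous Y d Q \<mu>" and F: "F \<subseteq> Y"
    and diam: "\<And>x y. x \<in> F \<Longrightarrow> y \<in> F \<Longrightarrow> d x y \<le> D" and r: "0 < r" "r \<le> D"
  shows "covers_by d (2 * r) F ((Q + 1) * (D / r) powr \<mu>)"
proof -
  have Q: "0 \<le> Q" "0 \<le> \<mu>" using hom unfolding homogeneous_def by auto
  have Dr: "1 \<le> (D / r) powr \<mu>" using r Q by (simp add: ge_one_powr_ge_zero)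
  show ?thesis
  \<comment> \<open>Homogeneity speaks only of \<open>r\<close> up to the diameter. If no two points
    are more than \<open>r\<close> apart, one set suffices; the bound has \<open>Q + 1\<close>
    because \<open>Q\<close> may be less than 1.\<close>
  proof (cases "\<forall>x\<in>F. \<forall>y\<in>F. d x y \<le> r")
    case True
    have "covers_by d (2 * r) F 1"
      unfolding covers_by_def using True r by (intro exI[of _ "{F}"]) force
    moreover have "1 \<le> (Q + 1) * (D / r) powr \<mu>"
      using mult_mono[of 1 "Q + 1" 1 "(D / r) powr \<mu>"] Dr Q by simp
    ultimately show ?thesis using covers_by_mono by blast
  next
    case False
    then obtain x y where xy: "x \<in> F" "y \<in> F" "r < d x y" by force
    have le: "ediam d F \<le> ereal D" unfolding ediam_le_iff using diam by blast
    have ge: "ereal (d x y) \<le> ediam d F"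
      unfolding ediam_def using xy by (intro SUP_upper2[of "(x,y)"]) auto
    obtain e where e: "ediam d F = ereal e" using le ge by (cases "ediam d F") auto
    have e': "r < e" "e \<le> D" using le ge e xy(3) by auto
    have "Cr d r F \<le> ereal (Q * (e / r) powr \<mu>)"
      using hom F r e e' unfolding homogeneous_def by auto
    also have "\<dots> \<le> ereal ((Q + 1) * (D / r) powr \<mu>)"
      using e' r Q by (auto intro!: mult_mono powr_mono2 divide_right_mono)
    finally have Cr: "Cr d r F \<le> ereal ((Q + 1) * (D / r) powr \<mu>)" .
    show ?thesis
    proof (rule covers_by_if_separated_bounded[OF assms(1)])
      fix S assume S: "finite S" "S \<subseteq> F" "\<And>x y. x \<in> S \<Longrightarrow> y \<in> S \<Longrightarrow> x \<noteq> y \<Longrightarrow> r < d x y"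
      have "ecard S \<le> Cr d r F"
        unfolding Cr_def using S gap_gt_if_finite[OF S(1,3)] by (intro SUP_upper) auto
      then have "ecard S \<le> ereal ((Q + 1) * (D / r) powr \<mu>)" using Cr by order
      then show "real (card S) \<le> (Q + 1) * (D / r) powr \<mu>" using S by (simp add: ecard_def)
    qed (use assms(2) F r in auto)
  qed
qed

text \<open>The pieces may have different exponents below \<open>t\<close>; since
  \<open>D / r \<ge> 1\<close>, all of them can be raised to the common exponent
  \<open>t\<close>.\<close>

lemma sigma_assouad_pieces:
  assumes "Metric_space X d" "sigma_assouad_dim X d < ereal t"
  obtains Xs :: "nat \<Rightarrow> 'a set" and K :: "nat \<Rightarrow> real"
  where "\<And>i. Xs i \<subseteq> X" "X = (\<Union>i. Xs i)" "\<And>i. 1 \<le> K i"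
    "\<And>i. \<forall>F\<subseteq>Xs i. \<forall>D r. (\<forall>x\<in>F. \<forall>y\<in>F. d x y \<le> D) \<longrightarrow> 0 < r \<longrightarrow> r \<le> D
       \<longrightarrow> covers_by d (2 * r) F (K i * (D / r) powr t)"
proof -
  obtain Xs :: "nat \<Rightarrow> 'a set" where Xs: "\<And>i. Xs i \<subseteq> X" "X \<subseteq> (\<Union>i. Xs i)"
      "(SUP i. assouad_dim (Xs i) d) < ereal t"
    using assms(2) unfolding sigma_assouad_dim_def Inf_less_iff by auto
  have "\<exists>Q \<mu>. homogeneous (Xs i) d Q \<mu> \<and> \<mu> < t" for i
  proof -
    have "assouad_dim (Xs i) d < ereal t" using Xs(3) by (meson SUP_lessD UNIV_I)
    then show ?thesis unfolding assouad_dim_def Inf_less_iff m_homogeneous_def by fastforce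
  qed
  then obtain Q \<mu> where hom: "\<And>i. homogeneous (Xs i) d (Q i) (\<mu> i)" "\<And>i. \<mu> i < t" by metis
  then have Q: "0 \<le> Q i" for i unfolding homogeneous_def by auto
  show ?thesis
  proof (rule that[of Xs "\<lambda>i. Q i + 1"], goal_cases)
    case (4 i)
    have "covers_by d (2 * r) F ((Q i + 1) * (D / r) powr t)"
      if *: "F \<subseteq> Xs i" "\<And>x y. x \<in> F \<Longrightarrow> y \<in> F \<Longrightarrow> d x y \<le> D" "0 < r" "r \<le> D" for F D r
    proof -
      have "covers_by d (2 * r) F ((Q i + 1) * (D / r) powr (\<mu> i))"
        by (rule homogeneous_covers_by[OF assms(1) Xs(1) hom(1) *])
      moreover have "(Q i + 1) * (D / r) powr (\<mu> i) \<le> (Q i + 1) * (D / r) powr t"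
        using Q[of i] hom(2)[of i] * by (intro mult_left_mono powr_mono) auto
      ultimately show ?thesis using covers_by_mono by blast
    qed
    then show ?case by blast
  qed (use Xs Q in auto)
qed

lemma powr_mult_two_power:
  fixes D t :: real
  assumes "0 < D"
  shows "(D / (1 / 2 ^ N)) powr t = D powr t * 2 powr (t * real N)"
  using assms by (simp add: powr_mult powr_powr mult.commute flip: powr_realpow)

text \<open>For each \<open>t > m\<close>, bounded parts of finitely many homogeneous pieces need
  \<open>O(2 powr (t N))\<close> sets at every scale \<open>2 / 2 ^ N\<close>, and unions of such
  parts exhaust \<open>X\<close>.\<close>

lemma inc_packing_dim_le_sigma_assouad_dim:
  assumes "Metric_space X d" "sigma_assouad_dim X d \<le> ereal m" "0 \<le> m"
  shows "inc_packing_dim X d X \<le> ereal m"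
proof (rule ccontr)
  assume "\<not> ?thesis"
  then obtain t where t: "ereal m < ereal t" "ereal t < inc_packing_dim X d X"
    using ereal_dense2 by (meson linorder_not_le)
  interpret Metric_space X d by fact
  have sig: "sigma_assouad_dim X d < ereal t" using assms(2) t by order
  obtain Xs :: "nat \<Rightarrow> 'a set" and K :: "nat \<Rightarrow> real"
    where Xs: "\<And>i. Xs i \<subseteq> X" "X = (\<Union>i. Xs i)" "\<And>i. 1 \<le> K i"
    "\<And>i. \<forall>F\<subseteq>Xs i. \<forall>D r. (\<forall>x\<in>F. \<forall>y\<in>F. d x y \<le> D) \<longrightarrow> 0 < r \<longrightarrow> r \<le> D
       \<longrightarrow> covers_by d (2 * r) F (K i * (D / r) powr t)"
    using sigma_assouad_pieces[OF assms(1) sig] by metis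
  \<comment> \<open>If \<open>X\<close> is empty, \<open>x0\<close> is arbitrary; its membership in
    \<open>X\<close> is used only in the presence of a point of \<open>X\<close>.\<close>
  define x0 where "x0 = (SOME x. x \<in> X)"
  have x0: "x0 \<in> X" if "x \<in> X" for x using someI[of "\<lambda>x. x \<in> X", OF that] unfolding x0_def .
  define E where "E q = (\<Union>i\<in>{..q}. Xs i \<inter> {x. d x0 x \<le> real q})" for q :: nat
  have "incseq E" unfolding incseq_def E_def by fastforce
  moreover have "(\<Union>q. E q) = X"
  proof
    show "X \<subseteq> (\<Union>q. E q)"
    proof
      fix x assume "x \<in> X"
      then obtain i where "x \<in> Xs i" using Xs by auto
      obtain p :: nat where "d x0 x \<le> real p" using real_arch_simple by blast
      then have "x \<in> E (max i p)" unfolding E_def using \<open>x \<in> Xs i\<close> by (auto intro!: bexI[of _ i])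
      then show "x \<in> (\<Union>q. E q)" by auto
    qed
  qed (use Xs in \<open>auto simp: E_def\<close>)
  moreover have "lower_box_dim X d (E q) \<le> ereal t" for q
  proof -
    \<comment> \<open>Points at distance at most \<open>q\<close> from \<open>x0\<close> are at most
      \<open>2 q\<close> apart; the extra 1 makes \<open>D\<close> at least as large as every scale
      \<open>1 / 2 ^ N\<close>.\<close>
    define D :: real where "D = 2 * real q + 1"
    define M where "M = (\<Sum>i\<in>{..q}. K i * D powr t)"
    have cov: "covers_by d (2 / 2 ^ N) (E q) ((1 + M) * 2 powr (t * real N))" for N
    proof -
      have "covers_by d (2 * (1 / 2 ^ N)) (Xs i \<inter> {x. d x0 x \<le> real q}) (K i * (D / (1 / 2 ^ N)) powr t)" for i
      proof (rule Xs(4)[rule_format])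
        show "d x y \<le> D" if "x \<in> Xs i \<inter> {x. d x0 x \<le> real q}" "y \<in> Xs i \<inter> {x. d x0 x \<le> real q}" for x y
        proof -
          have "x \<in> X" "y \<in> X" using that Xs(1) by auto
          then have "d x y \<le> d x0 x + d x0 y" using triangle[of x x0 y] commute[of x x0] x0 by simp
          then show ?thesis using that unfolding D_def by simp
        qed
        have "(1 / 2 ^ N :: real) \<le> 1" by simp
        then show "1 / 2 ^ N \<le> D" unfolding D_def by (smt (verit) of_nat_0_le_iff)
      qed auto
      then have "covers_by d (2 / 2 ^ N) (Xs i \<inter> {x. d x0 x \<le> real q}) (K i * D powr t * 2 powr (t * real N))" for i
        using powr_mult_two_power[of D N t] by (simp add: D_def mult.assoc)
      then have "covers_by d (2 / 2 ^ N) (E q) (\<Sum>i\<in>{..q}. K i * D powr t * 2 powr (t * real N))"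
        unfolding E_def by (intro covers_by_UN) auto
      also have "(\<Sum>i\<in>{..q}. K i * D powr t * 2 powr (t * real N)) = M * 2 powr (t * real N)"
        unfolding M_def by (simp add: sum_distrib_right)
      finally show ?thesis by (rule covers_by_mono) (auto intro!: mult_right_mono)
    qed
    have "0 \<le> K i" for i using Xs(3)[of i] by simp
    then have "0 \<le> M" unfolding M_def by (auto intro!: sum_nonneg)
    then show ?thesis using cov t assms(3) Xs(1)
      by (intro lower_box_dim_le[where c=2 and K="1+M"]) (auto simp: E_def)
  qed
  ultimately have "inc_packing_dim X d X \<le> ereal t"
    unfolding inc_packing_dim_def by (intro Inf_lower2[of "SUP n. lower_box_dim X d (E n)"] SUP_least) auto
  then show False using t by simp
qed

text \<open>Since the sets increase, a good scale chosen for \<open>E i\<close> also serves every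
  \<open>E n\<close> with \<open>n \<le> i\<close>. So all but finitely many of the chosen scales
  serve a given set, and the constant \<open>K\<close> absorbs the others. Scale 0 is added as a
  starting point for the choice of digits.\<close>

lemma inc_packing_dim_less_scales:
  assumes "inc_packing_dim X d X < ereal \<sigma>" "0 \<le> \<sigma>"
  obtains E :: "nat \<Rightarrow> 'a set" and L :: "nat set" where "(\<Union>n. E n) = X" "0 \<in> L" "infinite L"
    "\<And>n. \<exists>K\<ge>1. \<forall>l\<in>L. covers_by d (1 / 2 ^ l) (E n) (K * 2 powr (\<sigma> * real l))"
proof -
  obtain E :: "nat \<Rightarrow> 'a set" where E: "incseq E" "(\<Union>n. E n) = X"
      "(SUP n. lower_box_dim X d (E n)) < ereal \<sigma>"
    using assms(1) unfolding inc_packing_dim_def Inf_less_iff by auto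
  have "lower_box_dim X d (E n) < ereal \<sigma>" for n using E(3) by (meson SUP_lessD UNIV_I)
  then have "\<exists>N\<ge>n. covers_by d (1 / 2 ^ N) (E n) (2 powr \<sigma> * 2 powr (\<sigma> * real N))" for n
    using covers_by_of_lower_box_dim_less assms(2) by blast
  then obtain l where l: "\<And>n. n \<le> l n"
      "\<And>n. covers_by d (1 / 2 ^ l n) (E n) (2 powr \<sigma> * 2 powr (\<sigma> * real (l n)))" by metis
  show ?thesis
  proof (rule that[of E "insert 0 (range l)"])
    have "\<forall>n. \<exists>k>n. k \<in> range l" using l(1) by (metis Suc_le_eq rangeI)
    then show "infinite (insert 0 (range l))" by (auto simp: infinite_nat_iff_unbounded)
    fix n
    \<comment> \<open>At every scale \<open>E n\<close> has some finite cover, inherited from a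
      finer good scale of a larger set.\<close>
    have fin: "\<exists>M. covers_by d (1 / 2 ^ k) (E n) M" for k
    proof -
      let ?p = "max n k"
      have "(2::real) ^ k \<le> 2 ^ l ?p"
        using l(1)[of ?p] by (intro power_increasing) auto
      then have "(1 / 2 ^ l ?p :: real) \<le> 1 / 2 ^ k" by (simp add: frac_le)
      then show ?thesis using covers_by_mono[OF l(2)[of ?p]] incseqD[OF E(1), of n ?p] by auto
    qed
    then obtain M where M: "\<And>k. covers_by d (1 / 2 ^ k) (E n) (M k)" by metis
    define S where "S = insert 0 (l ` {..<n})"
    define K where "K = 2 powr \<sigma> + (\<Sum>k\<in>S. \<bar>M k\<bar>)"
    have S: "finite S" unfolding S_def by auto
    have "1 \<le> 2 powr \<sigma>" using assms(2) by (simp add: ge_one_powr_ge_zero)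
    then have "1 \<le> K" unfolding K_def by (simp add: add_increasing2 sum_nonneg)
    moreover have "covers_by d (1 / 2 ^ k) (E n) (K * 2 powr (\<sigma> * real k))" if k: "k \<in> insert 0 (range l)" for k
    proof (cases "k \<in> S")
      case True
      have "M k \<le> \<bar>M k\<bar>" by simp
      also have "\<dots> \<le> (\<Sum>k\<in>S. \<bar>M k\<bar>)" by (rule member_le_sum) (use True S in auto)
      also have "\<dots> \<le> K" unfolding K_def by simp
      also have "\<dots> \<le> K * 2 powr (\<sigma> * real k)"
        using \<open>1 \<le> K\<close> assms(2) by (simp add: ge_one_powr_ge_zero)
      finally show ?thesis using covers_by_mono[OF M] by blast
    next
      case False
      then obtain i where i: "k = l i" using k unfolding S_def by auto
      then have "n \<le> i" using False unfolding S_def by (auto simp: not_less[symmetric])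
      have "2 powr \<sigma> \<le> K" unfolding K_def by (simp add: sum_nonneg)
      then have "2 powr \<sigma> * 2 powr (\<sigma> * real k) \<le> K * 2 powr (\<sigma> * real k)"
        by (simp add: mult_right_mono)
      then show ?thesis using covers_by_mono[OF l(2)[of i], of "1 / 2 ^ k"] incseqD[OF E(1) \<open>n \<le> i\<close>] i
        by simp
    qed
    ultimately show "\<exists>K\<ge>1. \<forall>k\<in>insert 0 (range l). covers_by d (1 / 2 ^ k) (E n) (K * 2 powr (\<sigma> * real k))"
      by blast
  qed (use E in auto)
qed

text \<open>The counting function \<open>n \<mapsto> card (A \<inter> {..<n})\<close> is the smallest nondecreasing function
  with steps of at most one that reaches \<open>\<lfloor>\<alpha> l\<rfloor>\<close> at every \<open>l \<in> L\<close>.\<close>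

lemma digit_positions_exist:
  fixes L :: "nat set" and \<alpha> :: real
  assumes "0 \<in> L" "0 \<le> \<alpha>" "\<alpha> \<le> 1"
  obtains A :: "nat set" where "\<And>n. real (card (A \<inter> {..<n})) \<le> \<alpha> * real n"
    "\<And>l. l \<in> L \<Longrightarrow> \<alpha> * real l - 1 \<le> real (card (A \<inter> {..<l}))"
    "\<And>n. \<exists>l\<in>L. l \<le> n \<and> real (card (A \<inter> {..<n})) \<le> \<alpha> * real l \<or>
       n \<le> l \<and> real (card (A \<inter> {..<n})) \<le> \<alpha> * real l - (real l - real n)"
proof -
  define c where "c l = nat \<lfloor>\<alpha> * real l\<rfloor>" for l :: nat
  have c1: "real (c l) \<le> \<alpha> * real l" "\<alpha> * real l - 1 \<le> real (c l)" for l
    using mult_nonneg_nonneg[OF assms(2), of "real l"] unfolding c_def by linarith+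
  have al: "\<alpha> * real l \<le> real l" for l using assms(3) by (simp add: mult_left_le_one_le assms)
  have c2: "c l \<le> l" for l using c1(1)[of l] al[of l] by linarith
  \<comment> \<open>The lower bounds at \<open>n\<close> forced by the values \<open>c l\<close>
    when steps are at most one: \<open>c l\<close> itself for \<open>l \<le> n\<close>, and
    otherwise \<open>c l\<close> less the \<open>l - n\<close> steps still to come. Subtraction of
    naturals cuts these off at 0.\<close>
  define G where "G n = (\<lambda>l. c l - (l - n)) ` L" for n
  define g where "g n = Max (G n)" for n
  have G_le: "k \<le> n" if k: "k \<in> G n" for k n
  proof -
    obtain l where "k = c l - (l - n)" using k unfolding G_def by auto
    then show ?thesis using c2[of l] by linarith
  qed
  have fin: "finite (G n)" for n using G_le by (meson finite_nat_set_iff_bounded_le)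
  have ne: "G n \<noteq> {}" for n using assms(1) unfolding G_def by auto
  have g_ge: "c l - (l - n) \<le> g n" if "l \<in> L" for l n
    unfolding g_def using fin that by (intro Max_ge) (auto simp: G_def)
  have g_in: "\<exists>l\<in>L. g n = c l - (l - n)" for n
    using Max_in[OF fin[of n] ne[of n]] unfolding g_def G_def by auto
  have g0: "g 0 = 0" using Max_in[OF fin[of 0] ne[of 0]] G_le[of _ 0] unfolding g_def by auto
  have g_mono: "g n \<le> g (Suc n)" for n
  proof -
    obtain l where "l \<in> L" "g n = c l - (l - n)" using g_in by blast
    then show ?thesis using g_ge[of l "Suc n"] by linarith
  qed
  have g_step: "g (Suc n) \<le> Suc (g n)" for n
  proof -
    obtain l where "l \<in> L" "g (Suc n) = c l - (l - Suc n)" using g_in by blast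
    then show ?thesis using g_ge[of l n] by linarith
  qed
  \<comment> \<open>Every step of \<open>g\<close> has height 0 or 1 and \<open>g 0 = 0\<close>, so
    \<open>g\<close> counts its own jumps.\<close>
  define A where "A = {n. g (Suc n) \<noteq> g n}"
  have card: "card (A \<inter> {..<n}) = g n" for n
  proof (induction n)
    case (Suc n)
    have "A \<inter> {..<Suc n} = (if n \<in> A then insert n (A \<inter> {..<n}) else A \<inter> {..<n})"
      by (auto simp: less_Suc_eq)
    then show ?case using Suc g_mono[of n] g_step[of n] by (auto simp: A_def)
  qed (simp add: g0)
  have att: "\<exists>l\<in>L. l \<le> n \<and> real (g n) \<le> \<alpha> * real l \<or>
       n \<le> l \<and> real (g n) \<le> \<alpha> * real l - (real l - real n)" for n
  \<comment> \<open>A value 0 may stem from truncated subtraction, where the estimate in real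
    numbers can fail; scale 0 then fulfils the first alternative.\<close>
  proof (cases "g n = 0")
    case True
    then show ?thesis using assms(1) by (intro bexI[of _ 0]) auto
  next
    case False
    obtain l where l: "l \<in> L" "g n = c l - (l - n)" using g_in by blast
    show ?thesis
    proof (cases "l \<le> n")
      case True
      then show ?thesis using l c1(1)[of l] by auto
    next
      case False
      then have "real (g n) = real (c l) - (real l - real n)" using l \<open>g n \<noteq> 0\<close> by linarith
      then show ?thesis using False l c1(1)[of l] by (intro bexI[of _ l]) auto
    qed
  qed
  show ?thesis
  proof (rule that[of A])
    fix n
    obtain l where l: "l \<in> L" "l \<le> n \<and> real (g n) \<le> \<alpha> * real l \<or>
       n \<le> l \<and> real (g n) \<le> \<alpha> * real l - (real l - real n)" using att by blast
    have "\<alpha> * (real l - real n) \<le> real l - real n" if "n \<le> l"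
      using that assms by (simp add: mult_left_le_one_le)
    moreover have "\<alpha> * real l \<le> \<alpha> * real n" if "l \<le> n" using that assms by (simp add: mult_left_mono)
    ultimately show "real (card (A \<inter> {..<n})) \<le> \<alpha> * real n"
      unfolding card using l(2) by (auto simp: algebra_simps)
  next
    fix l assume "l \<in> L"
    then show "\<alpha> * real l - 1 \<le> real (card (A \<inter> {..<l}))"
      unfolding card using g_ge[of l l] c1(2)[of l] by simp
  next
    fix n show "\<exists>l\<in>L. l \<le> n \<and> real (card (A \<inter> {..<n})) \<le> \<alpha> * real l \<or>
       n \<le> l \<and> real (card (A \<inter> {..<n})) \<le> \<alpha> * real l - (real l - real n)"
      unfolding card by (rule att)
  qed
qed

section \<open>Sets of points with prescribed binary digits\<close>

lemma eucl_eq_L2_set: "eucl m x y = L2_set (\<lambda>i. x i - y i) {..<m}"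
  unfolding eucl_def L2_set_def ..

lemma abs_diff_le_eucl: "c < m \<Longrightarrow> \<bar>x c - y c\<bar> \<le> eucl m x y"
  using member_le_L2_set[of "{..<m}" c "\<lambda>i. \<bar>x i - y i\<bar>"] by (simp add: eucl_def L2_set_def)

lemma eucl_le:
  assumes "\<And>c. c < m \<Longrightarrow> \<bar>x c - y c\<bar> \<le> e"
  shows "eucl m x y \<le> real m * e"
proof -
  have "eucl m x y \<le> (\<Sum>i<m. \<bar>x i - y i\<bar>)"
    unfolding eucl_eq_L2_set by (rule L2_set_le_sum_abs)
  also have "\<dots> \<le> (\<Sum>i<m. e)" using assms by (intro sum_mono) auto
  finally show ?thesis by simp
qed

lemma Metric_space_Rm: "Metric_space (Rm m) (eucl m)"
proof
  fix x y z
  show "0 \<le> eucl m x y" unfolding eucl_def by (simp add: sum_nonneg)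
  show "eucl m x y = eucl m y x" unfolding eucl_def by (simp add: power2_commute)
  show "eucl m x z \<le> eucl m x y + eucl m y z"
    unfolding eucl_eq_L2_set using L2_set_triangle_ineq[of "\<lambda>i. x i - y i" "\<lambda>i. y i - z i" "{..<m}"] by simp
  show "(eucl m x y = 0) = (x = y)" if xy: "x \<in> Rm m" "y \<in> Rm m"
  proof
    assume "eucl m x y = 0"
    then have "x i = y i" for i
      using abs_diff_le_eucl[of i m x y] xy unfolding Rm_def by (cases "i < m") auto
    then show "x = y" by blast
  qed (simp add: eucl_def)
qed

text \<open>A set of pairs \<open>(c, i)\<close> lists the positions \<open>i\<close> at which the binary expansion of
  coordinate \<open>c\<close> has digit one.\<close>

definition binary_point :: "(nat \<times> nat) set \<Rightarrow> nat \<Rightarrow> real" where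
  "binary_point \<sigma> c = (\<Sum>i. if (c, i) \<in> \<sigma> then (1 / 2) ^ Suc i else 0)"

text \<open>All \<open>m\<close> coordinates have the same free positions. Cylinders are handled
  through the codes, because different codes can give the same point.\<close>

definition digit_set :: "nat \<Rightarrow> nat set \<Rightarrow> (nat \<Rightarrow> real) set" where
  "digit_set m A = binary_point ` Pow ({..<m} \<times> A)"

definition trunc :: "nat \<Rightarrow> (nat \<times> nat) set \<Rightarrow> (nat \<times> nat) set" where
  "trunc n \<sigma> = \<sigma> \<inter> UNIV \<times> {..<n}"

text \<open>The first \<open>n\<close> binary digits read as an integer, hence within 1 of
  \<open>2 ^ n\<close> times the coordinate; nearness of points becomes a bounded difference of
  integers.\<close>

fun leading_digits :: "nat \<Rightarrow> (nat \<times> nat) set \<Rightarrow> nat \<Rightarrow> int" where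
  "leading_digits 0 \<sigma> c = 0"
| "leading_digits (Suc n) \<sigma> c = 2 * leading_digits n \<sigma> c + (if (c, n) \<in> \<sigma> then 1 else 0)"

lemma trunc_trunc: "trunc n (trunc k \<sigma>) = trunc (min n k) \<sigma>"
  unfolding trunc_def by auto

lemma leading_digits_cong: "trunc n \<sigma> = trunc n \<tau> \<Longrightarrow> leading_digits n \<sigma> c = leading_digits n \<tau> c"
proof (induction n)
  case (Suc n)
  have "trunc n \<sigma> = trunc n \<tau>" using arg_cong[OF Suc.prems, of "trunc n"] by (simp add: trunc_trunc)
  moreover have "(c, n) \<in> \<sigma> \<longleftrightarrow> (c, n) \<in> \<tau>" using Suc.prems unfolding trunc_def by blast
  ultimately show ?case using Suc.IH by simp
qed simp

text \<open>Parity reveals the last digit, and what remains after halving reveals the earlier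
  ones.\<close>

lemma leading_digits_inj:
  "(\<And>c. leading_digits n \<sigma> c = leading_digits n \<tau> c) \<Longrightarrow> trunc n \<sigma> = trunc n \<tau>"
proof (induction n)
  case (Suc n)
  have "leading_digits n \<sigma> c = leading_digits n \<tau> c \<and> ((c, n) \<in> \<sigma> \<longleftrightarrow> (c, n) \<in> \<tau>)" for c
    using Suc.prems[of c] by (auto split: if_splits) presburger+
  then have "trunc n \<sigma> = trunc n \<tau>" "\<And>c. (c, n) \<in> \<sigma> \<longleftrightarrow> (c, n) \<in> \<tau>" using Suc.IH by auto
  then show ?case unfolding trunc_def by (simp add: lessThan_Suc set_eq_iff) blast
qed (simp add: trunc_def)

lemma leading_digits_outside: "(\<And>i. (c, i) \<notin> \<sigma>) \<Longrightarrow> leading_digits n \<sigma> c = 0"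
  by (induction n) auto

lemma summable_binary_point: "summable (\<lambda>i. if (c, i) \<in> \<sigma> then (1 / 2 :: real) ^ Suc i else 0)"
proof (rule summable_comparison_test')
  show "summable (\<lambda>i. (1 / 2 :: real) ^ Suc i)" using power_half_series sums_summable by blast
qed auto

text \<open>The digits from position \<open>n\<close> on contribute at least 0 and at most the full
  geometric series, \<open>1 / 2 ^ n\<close>.\<close>

lemma binary_point_bounds:
  shows "leading_digits n \<sigma> c / 2 ^ n \<le> binary_point \<sigma> c"
    and "binary_point \<sigma> c \<le> (leading_digits n \<sigma> c + 1) / 2 ^ n"
proof -
  let ?f = "\<lambda>i. if (c, i) \<in> \<sigma> then (1 / 2 :: real) ^ Suc i else 0"
  have head: "(\<Sum>i<n. ?f i) = leading_digits n \<sigma> c / 2 ^ n"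
    by (induction n) (auto simp: field_simps)
  have tail: "summable (\<lambda>i. ?f (i + n))"
    using summable_binary_point[of c \<sigma>] summable_iff_shift[of ?f n] by blast
  have geo: "(\<lambda>i. (1 / 2 :: real) ^ n * (1 / 2) ^ Suc i) sums ((1 / 2) ^ n * 1)"
    by (intro sums_mult power_half_series)
  have "(\<Sum>i. ?f (i + n)) \<le> (\<Sum>i. (1 / 2 :: real) ^ n * (1 / 2) ^ Suc i)"
    by (intro suminf_le tail sums_summable[OF geo]) (auto simp: power_add mult_ac)
  also have "\<dots> = 1 / 2 ^ n" using sums_unique[OF geo, symmetric] by (simp only: mult_1_right power_one_over)
  finally have "(\<Sum>i. ?f (i + n)) \<le> 1 / 2 ^ n" .
  moreover have "0 \<le> (\<Sum>i. ?f (i + n))" by (intro suminf_nonneg tail) auto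
  moreover have "binary_point \<sigma> c = (\<Sum>i. ?f (i + n)) + leading_digits n \<sigma> c / 2 ^ n"
    unfolding binary_point_def head[symmetric] by (rule suminf_split_initial_segment[OF summable_binary_point])
  ultimately show "leading_digits n \<sigma> c / 2 ^ n \<le> binary_point \<sigma> c"
    "binary_point \<sigma> c \<le> (leading_digits n \<sigma> c + 1) / 2 ^ n" by (simp_all add: add_divide_distrib)
qed

lemma digit_set_subset_Rm: "digit_set m A \<subseteq> Rm m"
proof -
  have "binary_point \<sigma> c = 0" if "\<sigma> \<subseteq> {..<m} \<times> A" "m \<le> c" for \<sigma> c
  proof -
    have "(c, i) \<notin> \<sigma>" for i using that by auto
    then show ?thesis unfolding binary_point_def by simp
  qed
  then show ?thesis unfolding digit_set_def Rm_def by auto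
qed

lemma digit_set_mono: "A \<subseteq> B \<Longrightarrow> digit_set m A \<subseteq> digit_set m B"
  unfolding digit_set_def by (intro image_mono Pow_mono Sigma_mono) auto

lemma eucl_binary_point_le:
  assumes "trunc n \<sigma> = trunc n \<tau>"
  shows "eucl m (binary_point \<sigma>) (binary_point \<tau>) \<le> real m / 2 ^ n"
proof -
  have "\<bar>binary_point \<sigma> c - binary_point \<tau> c\<bar> \<le> 1 / 2 ^ n" for c
    using binary_point_bounds[where n=n and \<sigma>=\<sigma> and c=c] binary_point_bounds[where n=n and \<sigma>=\<tau> and c=c]
      leading_digits_cong[OF assms, of c] by (simp add: add_divide_distrib)
  then show ?thesis using eucl_le[of m "binary_point \<sigma>" "binary_point \<tau>" "1 / 2 ^ n"] by simp
qed

text \<open>Leading digits of points this close differ by at most 2 in every coordinate. Relative to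
  a fixed code this leaves 5 possibilities per coordinate, and the leading digits determine the
  truncated code.\<close>

lemma card_binary_points_close:
  assumes sub: "\<And>\<sigma>. \<sigma> \<in> T \<Longrightarrow> \<sigma> \<subseteq> {..<m} \<times> UNIV" and inj: "inj_on (trunc n) T"
    and close: "\<And>\<sigma> \<tau>. \<sigma> \<in> T \<Longrightarrow> \<tau> \<in> T \<Longrightarrow> eucl m (binary_point \<sigma>) (binary_point \<tau>) \<le> 1 / 2 ^ n"
  shows "card T \<le> 5 ^ m"
proof (cases "T = {}")
  case False
  then obtain \<tau> where \<tau>: "\<tau> \<in> T" by blast
  define h where "h \<sigma> = restrict (\<lambda>c. leading_digits n \<sigma> c - leading_digits n \<tau> c) {..<m}" for \<sigma>
  \<comment> \<open>One unit comes from the distance of the points, another from the digits beyond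
    the first \<open>n\<close>.\<close>
  have le2: "leading_digits n \<sigma> c - leading_digits n \<rho> c \<le> 2" if "\<sigma> \<in> T" "\<rho> \<in> T" "c < m" for \<sigma> \<rho> c
  proof -
    have "\<bar>binary_point \<sigma> c - binary_point \<rho> c\<bar> \<le> 1 / 2 ^ n"
      using abs_diff_le_eucl[OF that(3)] close[OF that(1,2)] order_trans by blast
    then have "binary_point \<sigma> c \<le> binary_point \<rho> c + 1 / 2 ^ n" by (simp add: abs_le_iff)
    then have "real_of_int (leading_digits n \<sigma> c) / 2 ^ n \<le> (leading_digits n \<rho> c + 1) / 2 ^ n + 1 / 2 ^ n"
      using binary_point_bounds(1)[where n=n and \<sigma>=\<sigma> and c=c] binary_point_bounds(2)[where n=n and \<sigma>=\<rho> and c=c] by linarith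
    then have "real_of_int (leading_digits n \<sigma> c) / 2 ^ n \<le> (leading_digits n \<rho> c + 2) / 2 ^ n"
      by (simp add: add_divide_distrib)
    then have "real_of_int (leading_digits n \<sigma> c) \<le> leading_digits n \<rho> c + 2"
      by (simp add: divide_le_cancel)
    then show ?thesis by linarith
  qed
  have "h ` T \<subseteq> {..<m} \<rightarrow>\<^sub>E {-2..2}"
    using le2[OF _ \<tau>] le2[OF \<tau>] unfolding h_def by (force simp: PiE_iff)
  moreover have "inj_on h T"
  proof
    fix \<sigma> \<rho> assume *: "\<sigma> \<in> T" "\<rho> \<in> T" "h \<sigma> = h \<rho>"
    have "leading_digits n \<sigma> c = leading_digits n \<rho> c" for c
    proof (cases "c < m")
      case True
      then show ?thesis using fun_cong[OF *(3), of c] by (simp add: h_def)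
    next
      case False
      then have "(c, i) \<notin> \<sigma>" "(c, i) \<notin> \<rho>" for i using sub[OF *(1)] sub[OF *(2)] by auto
      then show ?thesis by (simp add: leading_digits_outside)
    qed
    then show "\<sigma> = \<rho>" using leading_digits_inj inj * by (metis inj_onD)
  qed
  moreover have "finite ({..<m} \<rightarrow>\<^sub>E {-2..2::int})" by (intro finite_PiE) auto
  ultimately have "card T \<le> card ({..<m} \<rightarrow>\<^sub>E {-2..2::int})" by (meson card_inj_on_le)
  also have "\<dots> = 5 ^ m" by (simp add: card_PiE)
  finally show ?thesis .
qed simp

lemma card_Pow_digits:
  fixes A :: "nat set"
  shows "card (Pow ({..<m} \<times> (A \<inter> {..<n}))) = 2 ^ (m * card (A \<inter> {..<n}))"
  by (simp add: card_Pow card_cartesian_product)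

text \<open>One piece for each admissible word of length \<open>n\<close>: points with the same word
  differ by at most \<open>1 / 2 ^ n\<close> in each of the \<open>m\<close> coordinates.\<close>

lemma covers_by_digit_set:
  "covers_by (eucl m) (real m / 2 ^ n) (digit_set m A) (2 ^ (m * card (A \<inter> {..<n})))"
proof -
  let ?W = "Pow ({..<m} \<times> (A \<inter> {..<n}))"
  define C where "C = (\<lambda>\<tau>. binary_point ` {\<sigma> \<in> Pow ({..<m} \<times> A). trunc n \<sigma> = \<tau>}) ` ?W"
  have "card C \<le> 2 ^ (m * card (A \<inter> {..<n}))"
    unfolding C_def card_Pow_digits[symmetric] by (rule card_image_le) auto
  then have "real (card C) \<le> 2 ^ (m * card (A \<inter> {..<n}))"
    by (metis of_nat_le_iff of_nat_numeral of_nat_power)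
  moreover have "\<forall>F\<in>C. \<forall>x\<in>F. \<forall>y\<in>F. eucl m x y \<le> real m / 2 ^ n"
    unfolding C_def by (auto intro!: eucl_binary_point_le)
  moreover have "digit_set m A \<subseteq> \<Union>C"
  proof
    fix x assume "x \<in> digit_set m A"
    then obtain \<sigma> where \<sigma>: "\<sigma> \<subseteq> {..<m} \<times> A" "x = binary_point \<sigma>" unfolding digit_set_def by auto
    then have "trunc n \<sigma> \<in> ?W" unfolding trunc_def by auto
    then show "x \<in> \<Union>C" unfolding C_def using \<sigma> by blast
  qed
  moreover have "finite C" unfolding C_def by auto
  ultimately show ?thesis unfolding covers_by_def by blast
qed

section \<open>Compactness of digit sets and of unions shrinking to the origin\<close>

lemma compactin_digit_set: "compactin (Metric_space.mtopology (Rm m) (eucl m)) (digit_set m A)"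
proof -
  interpret R: Metric_space "Rm m" "eucl m" by (rule Metric_space_Rm)
  \<comment> \<open>The digit set is a continuous image of a product of finite discrete spaces,
    which is compact by Tychonoff; positions that are not free carry the one-point factor
    \<open>{False}\<close>.\<close>
  define U where "U p = (if p \<in> {..<m} \<times> A then UNIV else {False})" for p :: "nat \<times> nat"
  define T where "T = product_topology (\<lambda>p. discrete_topology (U p)) UNIV"
  have topT: "topspace T = {y. \<forall>p. y p \<in> U p}" unfolding T_def by (auto simp: PiE_iff)
  define f where "f y = binary_point {p. y p}" for y
  have img: "f ` topspace T = digit_set m A"
  proof
    show "f ` topspace T \<subseteq> digit_set m A"
      unfolding f_def topT digit_set_def U_def by (fastforce split: if_splits)
    show "digit_set m A \<subseteq> f ` topspace T"
    proof
      fix x assume "x \<in> digit_set m A"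
      then obtain \<sigma> where \<sigma>: "\<sigma> \<subseteq> {..<m} \<times> A" "x = binary_point \<sigma>" unfolding digit_set_def by auto
      then have "(\<lambda>p. p \<in> \<sigma>) \<in> topspace T" "x = f (\<lambda>p. p \<in> \<sigma>)" unfolding topT f_def U_def by auto
      then show "x \<in> f ` topspace T" by blast
    qed
  qed
  have "compact_space T"
    unfolding T_def compact_space_product_topology by (auto simp: compact_space_discrete_topology)
  moreover have "continuous_map T R.mtopology f"
    unfolding R.continuous_map_to_metric
  proof (intro ballI allI impI)
    fix x and \<epsilon> :: real assume x: "x \<in> topspace T" and \<epsilon>: "0 < \<epsilon>"
    have "(\<lambda>n. real m / 2 ^ n) \<longlonglongrightarrow> 0" by real_asymp
    then have "\<forall>\<^sub>F n in sequentially. real m / 2 ^ n < \<epsilon>" using \<epsilon> by (auto dest: order_tendstoD)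
    then obtain n where n: "real m / 2 ^ n < \<epsilon>" by (auto simp: eventually_sequentially)
    \<comment> \<open>A basic open set fixes finitely many digits. Those below \<open>n\<close> in
      the first \<open>m\<close> coordinates suffice, since all digits of the other coordinates are
      \<open>False\<close>.\<close>
    define B where "B p = (if p \<in> {..<m} \<times> {..<n} then {x p} else U p)" for p
    have xU: "x p \<in> U p" for p using x unfolding topT by blast
    have "{p. B p \<noteq> U p} \<subseteq> {..<m} \<times> {..<n}" unfolding B_def by auto
    then have "finite {p. B p \<noteq> U p}" by (rule finite_subset) auto
    moreover have "B p \<subseteq> U p" for p using xU unfolding B_def by auto
    ultimately have "openin T (PiE UNIV B)"
      unfolding T_def openin_PiE_gen by auto
    moreover have "x \<in> PiE UNIV B" using xU unfolding B_def by auto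
    moreover have "f y \<in> R.mball (f x) \<epsilon>" if y: "y \<in> PiE UNIV B" for y
    proof -
      have yB: "y p \<in> B p" for p using y by auto
      have "y p \<in> U p" for p using yB[of p] \<open>\<And>p. B p \<subseteq> U p\<close> by blast
      then have "y \<in> topspace T" unfolding topT by auto
      then have Rm: "f x \<in> Rm m" "f y \<in> Rm m" using img x digit_set_subset_Rm by blast+
      have "x (c, i) = y (c, i)" if "i < n" for c i
        using yB[of "(c, i)"] xU[of "(c, i)"] that unfolding B_def U_def by (auto split: if_splits)
      then have "trunc n {p. x p} = trunc n {p. y p}" unfolding trunc_def by auto
      then have "eucl m (f x) (f y) \<le> real m / 2 ^ n" unfolding f_def by (rule eucl_binary_point_le)
      then show ?thesis using Rm n by simp
    qed
    ultimately show "\<exists>V. openin T V \<and> x \<in> V \<and> (\<forall>y\<in>V. f y \<in> R.mball (f x) \<epsilon>)" by blast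
  qed
  ultimately show ?thesis using image_compactin[of T "topspace T" R.mtopology f] img
    by (simp add: compact_space_def)
qed

text \<open>All these sets contain the origin, and those with \<open>j \<ge> n\<close> lie within
  \<open>m / 2 ^ n\<close> of it. Hence one member of an open cover takes care of all but finitely
  many of the compact sets.\<close>

lemma compactin_UN_digit_sets:
  "compactin (Metric_space.mtopology (Rm m) (eucl m)) (\<Union>j. digit_set m (A j \<inter> {j..}))"
proof -
  interpret R: Metric_space "Rm m" "eucl m" by (rule Metric_space_Rm)
  let ?Z = "\<lambda>j. digit_set m (A j \<inter> {j..})"
  show ?thesis unfolding compactin_def
  proof (intro conjI allI impI)
    show "(\<Union>j. ?Z j) \<subseteq> topspace R.mtopology" using digit_set_subset_Rm by auto
    fix \<U> assume \<U>: "Ball \<U> (openin R.mtopology) \<and> (\<Union>j. ?Z j) \<subseteq> \<Union>\<U>"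
    have zero: "binary_point {} \<in> ?Z j" for j unfolding digit_set_def by auto
    have cov: "(\<Union>j. ?Z j) \<subseteq> \<Union>\<U>" and op: "\<And>U. U \<in> \<U> \<Longrightarrow> openin R.mtopology U"
      using \<U> by (simp_all only: simp_thms Ball_def)
    have "binary_point {} \<in> (\<Union>j. ?Z j)" using zero by blast
    then have "binary_point {} \<in> \<Union>\<U>" by (rule subsetD[OF cov])
    then obtain U where U: "U \<in> \<U>" "binary_point {} \<in> U" by (rule UnionE)
    obtain r where r: "r > 0" "R.mball (binary_point {}) r \<subseteq> U"
      using op[OF U(1)] U(2) unfolding R.openin_mtopology by blast
    have "(\<lambda>n. real m / 2 ^ n) \<longlonglongrightarrow> 0" by real_asymp
    then have "\<forall>\<^sub>F n in sequentially. real m / 2 ^ n < r" using r by (auto dest: order_tendstoD)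
    then obtain n where n: "real m / 2 ^ n < r" by (auto simp: eventually_sequentially)
    have tail: "?Z j \<subseteq> U" if j: "n \<le> j" for j
    proof
      fix x assume x: "x \<in> ?Z j"
      then obtain \<sigma> where \<sigma>: "\<sigma> \<subseteq> {..<m} \<times> (A j \<inter> {j..})" "x = binary_point \<sigma>"
        unfolding digit_set_def by auto
      have "trunc n {} = trunc n \<sigma>" using \<sigma>(1) j unfolding trunc_def by fastforce
      then have "eucl m (binary_point {}) x \<le> real m / 2 ^ n" unfolding \<sigma>(2) by (rule eucl_binary_point_le)
      then have "x \<in> R.mball (binary_point {}) r"
        using n x zero[of j] digit_set_subset_Rm[of m] by auto
      then show "x \<in> U" using r by blast
    qed
    have "compactin R.mtopology (\<Union>j<n. ?Z j)"
      by (intro compactin_Union) (auto simp: compactin_digit_set)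
    moreover have "(\<Union>j<n. ?Z j) \<subseteq> \<Union>\<U>" by (rule order_trans[OF _ cov]) auto
    ultimately obtain \<F> where \<F>: "finite \<F>" "\<F> \<subseteq> \<U>" "(\<Union>j<n. ?Z j) \<subseteq> \<Union>\<F>"
      using op unfolding compactin_def by meson
    have "(\<Union>j. ?Z j) \<subseteq> \<Union>(insert U \<F>)"
    proof
      fix x assume "x \<in> (\<Union>j. ?Z j)"
      then obtain j where "x \<in> ?Z j" by blast
      then show "x \<in> \<Union>(insert U \<F>)" using tail[of j] \<F>(3) by (cases "j < n") auto
    qed
    then show "\<exists>\<F>. finite \<F> \<and> \<F> \<subseteq> \<U> \<and> (\<Union>j. ?Z j) \<subseteq> \<Union>\<F>"
      using \<F> U(1) by (intro exI[of _ "insert U \<F>"]) auto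
  qed
qed

section \<open>The lower bound for products\<close>

text \<open>The Baire category argument: otherwise every cylinder contains, for each \<open>k\<close>, a smaller one
  that misses \<open>S k\<close>, and nested cylinders missing \<open>S 0, S 1, \<dots>\<close> shrink to an uncovered
  point.\<close>

lemma dense_in_cylinder:
  fixes S :: "nat \<Rightarrow> (nat \<times> nat) set set"
  assumes cover: "\<And>\<sigma>. \<sigma> \<subseteq> {..<m} \<times> A \<Longrightarrow> \<exists>k. \<sigma> \<in> S k"
  shows "\<exists>k n. \<exists>\<tau>\<in>Pow ({..<m} \<times> (A \<inter> {..<n})). \<forall>N\<ge>n. \<forall>\<rho>\<in>Pow ({..<m} \<times> (A \<inter> {..<N})).
    trunc n \<rho> = \<tau> \<longrightarrow> (\<exists>\<sigma>\<subseteq>{..<m} \<times> A. trunc N \<sigma> = \<rho> \<and> \<sigma> \<in> S k)"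
proof (rule ccontr)
  assume none: "\<not> ?thesis"
  define W where "W n = Pow ({..<m} \<times> (A \<inter> {..<n}))" for n
  define avoid where "avoid k N \<rho> \<longleftrightarrow> (\<forall>\<sigma>\<subseteq>{..<m} \<times> A. trunc N \<sigma> = \<rho> \<longrightarrow> \<sigma> \<notin> S k)" for k N \<rho>
  have ex: "\<exists>N \<rho>. n \<le> N \<and> \<rho> \<in> W N \<and> trunc n \<rho> = \<tau> \<and> avoid k N \<rho>" if "\<tau> \<in> W n" for k n \<tau>
    using none that unfolding W_def avoid_def by meson
  \<comment> \<open>The states are pairs of a length and a word; step \<open>k\<close> extends the
    word to one whose cylinder misses \<open>S k\<close>.\<close>
  have "\<exists>f. \<forall>k. snd (f k) \<in> W (fst (f k)) \<and>
      (fst (f k) \<le> fst (f (Suc k)) \<and> trunc (fst (f k)) (snd (f (Suc k))) = snd (f k) \<and>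
        avoid k (fst (f (Suc k))) (snd (f (Suc k))))"
  proof (rule dependent_nat_choice)
    show "\<exists>x. snd x \<in> W (fst x)" by (rule exI[of _ "(0, {})"]) (simp add: W_def)
    fix x :: "nat \<times> (nat \<times> nat) set" and k assume "snd x \<in> W (fst x)"
    from ex[OF this, of k] obtain N \<rho> where "fst x \<le> N \<and> \<rho> \<in> W N \<and> trunc (fst x) \<rho> = snd x \<and> avoid k N \<rho>"
      by blast
    then show "\<exists>y. snd y \<in> W (fst y) \<and> (fst x \<le> fst y \<and> trunc (fst x) (snd y) = snd x \<and> avoid k (fst y) (snd y))"
      by (intro exI[of _ "(N, \<rho>)"]) simp
  qed
  then obtain f where f: "\<And>k. snd (f k) \<in> W (fst (f k))" "\<And>k. fst (f k) \<le> fst (f (Suc k))"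
      "\<And>k. trunc (fst (f k)) (snd (f (Suc k))) = snd (f k)"
      "\<And>k. avoid k (fst (f (Suc k))) (snd (f (Suc k)))" by auto
  define n \<tau> where "n k = fst (f k)" and "\<tau> k = snd (f k)" for k
  have n_mono: "n k \<le> n j" if "k \<le> j" for k j
    using that f(2) unfolding n_def by (rule lift_Suc_mono_le[rotated])
  have nest: "trunc (n k) (\<tau> j) = \<tau> k" if "k \<le> j" for k j
    using that
  proof (induction rule: dec_induct)
    case base
    show ?case using f(1)[of k] unfolding n_def \<tau>_def W_def trunc_def by auto
  next
    case (step j)
    have "\<tau> k = trunc (n k) (trunc (n j) (\<tau> (Suc j)))" using step f(3)[of j] unfolding n_def \<tau>_def by simp
    also have "\<dots> = trunc (n k) (\<tau> (Suc j))" using n_mono[of k j] step(1) by (simp add: trunc_trunc)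
    finally show ?case ..
  qed
  \<comment> \<open>Each word is a truncation of all later ones, so their union is a code lying in
    all the chosen cylinders.\<close>
  define \<sigma> where "\<sigma> = (\<Union>k. \<tau> k)"
  have sub: "\<sigma> \<subseteq> {..<m} \<times> A" using f(1) unfolding \<sigma>_def \<tau>_def W_def by fastforce
  have tr: "trunc (n k) \<sigma> = \<tau> k" for k
  proof
    show "\<tau> k \<subseteq> trunc (n k) \<sigma>" using nest[of k k] unfolding \<sigma>_def trunc_def by auto
    show "trunc (n k) \<sigma> \<subseteq> \<tau> k"
    proof
      fix p assume "p \<in> trunc (n k) \<sigma>"
      then obtain j where j: "p \<in> trunc (n k) (\<tau> j)" unfolding \<sigma>_def trunc_def by auto
      show "p \<in> \<tau> k"
      proof (cases "k \<le> j")
        case True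
        then show ?thesis using nest j by blast
      next
        case False
        then show ?thesis using nest[of j k] j unfolding trunc_def by fastforce
      qed
    qed
  qed
  obtain k where "\<sigma> \<in> S k" using cover[OF sub] by blast
  then show False using f(4)[of k] tr[of "Suc k"] sub unfolding avoid_def n_def \<tau>_def by blast
qed

text \<open>The free positions from \<open>n\<close> up to \<open>N\<close> can be filled
  arbitrarily, and at most \<open>n\<close> lie below. So a cylinder of level \<open>n\<close> keeps
  at least the fraction \<open>1 / 2 ^ (m * n)\<close> of the words of length
  \<open>N\<close>.\<close>

lemma card_cylinder_extensions:
  fixes A :: "nat set"
  assumes "\<tau> \<subseteq> {..<m} \<times> (A \<inter> {..<n})" "n \<le> N"
  shows "2 ^ (m * card (A \<inter> {..<N})) \<le> 2 ^ (m * n) * card {\<rho> \<in> Pow ({..<m} \<times> (A \<inter> {..<N})). trunc n \<rho> = \<tau>}"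
proof -
  let ?T = "{\<rho> \<in> Pow ({..<m} \<times> (A \<inter> {..<N})). trunc n \<rho> = \<tau>}"
  let ?R = "Pow ({..<m} \<times> (A \<inter> {n..<N}))"
  have "inj_on (\<lambda>\<rho>. \<tau> \<union> \<rho>) ?R"
  proof
    fix \<rho> \<rho>' assume *: "\<rho> \<in> ?R" "\<rho>' \<in> ?R" "\<tau> \<union> \<rho> = \<tau> \<union> \<rho>'"
    then have "\<tau> \<inter> \<rho> = {}" "\<tau> \<inter> \<rho>' = {}" using assms(1) by fastforce+
    then show "\<rho> = \<rho>'" using *(3) by blast
  qed
  moreover have "(\<lambda>\<rho>. \<tau> \<union> \<rho>) ` ?R \<subseteq> ?T" using assms unfolding trunc_def by fastforce
  ultimately have "card ?R \<le> card ?T" by (rule card_inj_on_le) auto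
  then have "2 ^ (m * card (A \<inter> {n..<N})) \<le> card ?T" by (simp add: card_Pow card_cartesian_product)
  moreover have "card (A \<inter> {..<N}) \<le> n + card (A \<inter> {n..<N})"
  proof -
    have "A \<inter> {..<N} \<subseteq> {..<n} \<union> (A \<inter> {n..<N})" by auto
    then have "card (A \<inter> {..<N}) \<le> card ({..<n} \<union> (A \<inter> {n..<N}))" by (intro card_mono) auto
    also have "\<dots> \<le> n + card (A \<inter> {n..<N})" using card_Un_le[of "{..<n}"] by simp
    finally show ?thesis .
  qed
  then have "(2::nat) ^ (m * card (A \<inter> {..<N})) \<le> 2 ^ (m * (n + card (A \<inter> {n..<N})))"
    by (intro power_increasing mult_le_mono) auto
  then have "(2::nat) ^ (m * card (A \<inter> {..<N})) \<le> 2 ^ (m * n) * 2 ^ (m * card (A \<inter> {n..<N}))"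
    by (simp only: power_add distrib_left)
  ultimately show ?thesis by (meson mult_le_mono2 order_trans)
qed

text \<open>One point of \<open>F\<close> is selected for each pair in \<open>S \<times> T\<close>.
  The selected points in one set of the cover have the same first component, as \<open>S\<close> is
  separated, and then at most \<open>5 ^ m\<close> words by
  \<open>card_binary_points_close\<close>.\<close>

lemma card_separated_cylinder_le:
  assumes cov: "covers_by (max_metric d (eucl m)) (1 / 2 ^ N) F M"
    and S: "finite S" "\<And>x y. x \<in> S \<Longrightarrow> y \<in> S \<Longrightarrow> x \<noteq> y \<Longrightarrow> 1 / 2 ^ N < d x y"
    and T: "finite T"
    and ext: "\<And>x \<rho>. x \<in> S \<Longrightarrow> \<rho> \<in> T \<Longrightarrow> \<exists>\<sigma>\<subseteq>{..<m} \<times> A. trunc N \<sigma> = \<rho> \<and> (x, binary_point \<sigma>) \<in> F"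
  shows "real (card S * card T) \<le> 5 ^ m * M"
proof -
  obtain C where C: "finite C" "\<forall>G\<in>C. \<forall>x\<in>G. \<forall>y\<in>G. max_metric d (eucl m) x y \<le> 1 / 2 ^ N"
      "F \<subseteq> \<Union>C" "real (card C) \<le> M"
    using cov unfolding covers_by_def by blast
  define s where "s p = (SOME \<sigma>. \<sigma> \<subseteq> {..<m} \<times> A \<and> trunc N \<sigma> = snd p \<and> (fst p, binary_point \<sigma>) \<in> F)" for p
  have s: "s p \<subseteq> {..<m} \<times> A \<and> trunc N (s p) = snd p \<and> (fst p, binary_point (s p)) \<in> F"
    if "p \<in> S \<times> T" for p
    unfolding s_def by (rule someI_ex) (use ext[of "fst p" "snd p"] that in auto)
  define fib where "fib G = {p \<in> S \<times> T. (fst p, binary_point (s p)) \<in> G}" for G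
  have fin: "finite (fib G)" for G unfolding fib_def using S(1) T by auto
  have card_fib: "card (fib G) \<le> 5 ^ m" if G: "G \<in> C" for G
  proof -
    have close: "max_metric d (eucl m) (fst p, binary_point (s p)) (fst q, binary_point (s q)) \<le> 1 / 2 ^ N"
      if "p \<in> fib G" "q \<in> fib G" for p q using that C(2) G unfolding fib_def by blast
    have same: "fst p = fst q" if "p \<in> fib G" "q \<in> fib G" for p q
    proof (rule ccontr)
      assume "fst p \<noteq> fst q"
      moreover have "fst p \<in> S" "fst q \<in> S" using that unfolding fib_def by auto
      ultimately have "1 / 2 ^ N < d (fst p) (fst q)" using S(2) by blast
      then show False using close[OF that] unfolding max_metric_def by simp
    qed
    have tr: "trunc N (s p) = snd p" "s p \<subseteq> {..<m} \<times> UNIV" if "p \<in> fib G" for p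
      using s[of p] that unfolding fib_def by blast+
    have "inj_on s (fib G)"
      using same tr(1) by (intro inj_onI) (metis prod_eqI)
    then have "card (fib G) = card (s ` fib G)" by (simp add: card_image)
    also have "\<dots> \<le> 5 ^ m"
    proof (rule card_binary_points_close)
      show "\<sigma> \<subseteq> {..<m} \<times> UNIV" if "\<sigma> \<in> s ` fib G" for \<sigma> using that tr(2) by blast
      show "inj_on (trunc N) (s ` fib G)"
      proof (rule inj_onI)
        fix \<sigma> \<sigma>' assume "\<sigma> \<in> s ` fib G" "\<sigma>' \<in> s ` fib G" and eq: "trunc N \<sigma> = trunc N \<sigma>'"
        then obtain p q where pq: "p \<in> fib G" "q \<in> fib G" "\<sigma> = s p" "\<sigma>' = s q" by blast
        then have "snd p = snd q" using tr(1) eq by metis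
        then have "p = q" using same[OF pq(1,2)] by (simp add: prod_eq_iff)
        then show "\<sigma> = \<sigma>'" using pq by simp
      qed
      show "eucl m (binary_point \<sigma>) (binary_point \<sigma>') \<le> 1 / 2 ^ N" if \<sigma>: "\<sigma> \<in> s ` fib G" "\<sigma>' \<in> s ` fib G" for \<sigma> \<sigma>'
      proof -
        obtain p q where pq: "p \<in> fib G" "q \<in> fib G" "\<sigma> = s p" "\<sigma>' = s q" using \<sigma> by blast
        show ?thesis using close[OF pq(1,2)] pq(3,4) unfolding max_metric_def by simp
      qed
    qed
    finally show ?thesis .
  qed
  have "S \<times> T \<subseteq> (\<Union>G\<in>C. fib G)" using s C(3) unfolding fib_def by fastforce
  then have "card (S \<times> T) \<le> card (\<Union>G\<in>C. fib G)" using fin C(1) by (intro card_mono) auto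
  also have "\<dots> \<le> (\<Sum>G\<in>C. card (fib G))" by (rule card_UN_le[OF C(1)])
  also have "\<dots> \<le> (\<Sum>G\<in>C. 5 ^ m)" using card_fib by (intro sum_mono)
  finally have "card S * card T \<le> card C * 5 ^ m" by (simp add: card_cartesian_product)
  then have "real (card S * card T) \<le> real (card C * 5 ^ m)" by (rule of_nat_mono)
  also have "\<dots> = 5 ^ m * real (card C)" by simp
  also have "\<dots> \<le> 5 ^ m * M" using C(4) by (intro mult_left_mono) auto
  finally show ?thesis .
qed

text \<open>Over each \<open>x\<close> finitely many pieces are dense in some cylinder. At scales
  where \<open>A\<close> has nearly \<open>\<alpha> N\<close> positions, counting pairs of points
  and words leaves the exponent \<open>t - m \<alpha>\<close> for the points. These scales depend on
  \<open>A\<close> alone, so they serve finitely many cylinders at once.\<close>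

lemma inc_packing_dim_le_if_product_covered:
  fixes Es :: "nat \<Rightarrow> ('a \<times> (nat \<Rightarrow> real)) set"
  assumes "Metric_space X d" "X \<noteq> {}"
    and cover: "X \<times> digit_set m A \<subseteq> (\<Union>n. Es n)"
    and Es: "\<And>n. \<forall>\<^sub>F N in sequentially. covers_by (max_metric d (eucl m)) (1 / 2 ^ N) (Es n) (2 powr (t * real N))"
    and dens: "\<exists>\<^sub>F N in sequentially. \<alpha> * real N - K \<le> real (card (A \<inter> {..<N}))"
  shows "inc_packing_dim X d X \<le> ereal (t - real m * \<alpha>)"
proof -
  define u where "u = t - real m * \<alpha>"
  define F where "F k = (\<Union>i\<in>{..k}. Es i)" for k :: nat
  have F_mono: "F k \<subseteq> F k'" if "k \<le> k'" for k k' using that unfolding F_def by fastforce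
  define W where "W n = Pow ({..<m} \<times> (A \<inter> {..<n}))" for n :: nat
  \<comment> \<open>The points whose slice of \<open>F k\<close> is dense in the cylinder
    \<open>p\<close>, in the sense that it meets every subcylinder.\<close>
  define Y where "Y k p = {x \<in> X. \<forall>N\<ge>fst p. \<forall>\<rho>\<in>W N. trunc (fst p) \<rho> = snd p \<longrightarrow>
      (\<exists>\<sigma>\<subseteq>{..<m} \<times> A. trunc N \<sigma> = \<rho> \<and> (x, binary_point \<sigma>) \<in> F k)}" for k and p :: "nat \<times> (nat \<times> nat) set"
  \<comment> \<open>Letting \<open>q\<close> bound both the level of the cylinder and the index of
    \<open>F\<close> gives finite unions that increase to \<open>X\<close>.\<close>
  define I where "I q = Sigma {..q} W" for q :: nat
  define G where "G q = (\<Union>p\<in>I q. Y q p)" for q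
  have finI: "finite (I q)" for q unfolding I_def W_def by auto
  have Y_mono: "Y k p \<subseteq> Y k' p" if "k \<le> k'" for k k' p
  proof
    fix x assume "x \<in> Y k p"
    then show "x \<in> Y k' p" unfolding Y_def mem_Collect_eq using F_mono[OF that] by (meson subsetD)
  qed
  have "incseq G"
  proof (rule incseq_SucI)
    fix q
    have "I q \<subseteq> I (Suc q)" unfolding I_def by auto
    then show "G q \<subseteq> G (Suc q)" unfolding G_def using Y_mono[of q "Suc q"] by (intro UN_mono) auto
  qed
  have G_sub: "G q \<subseteq> X" for q unfolding G_def Y_def by auto
  have G_Un: "(\<Union>q. G q) = X"
  proof
    show "X \<subseteq> (\<Union>q. G q)"
    proof
      fix x assume x: "x \<in> X"
      have "\<exists>k. \<sigma> \<in> {\<sigma>. (x, binary_point \<sigma>) \<in> F k}" if "\<sigma> \<subseteq> {..<m} \<times> A" for \<sigma>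
      proof -
        have "(x, binary_point \<sigma>) \<in> X \<times> digit_set m A" using x that unfolding digit_set_def by blast
        then obtain k where "(x, binary_point \<sigma>) \<in> Es k" using cover by blast
        then show ?thesis unfolding F_def by blast
      qed
      from dense_in_cylinder[of m A "\<lambda>k. {\<sigma>. (x, binary_point \<sigma>) \<in> F k}", OF this]
      obtain k n \<tau> where \<tau>: "\<tau> \<in> W n" and
        dense: "\<forall>N\<ge>n. \<forall>\<rho>\<in>W N. trunc n \<rho> = \<tau> \<longrightarrow>
          (\<exists>\<sigma>\<subseteq>{..<m} \<times> A. trunc N \<sigma> = \<rho> \<and> (x, binary_point \<sigma>) \<in> F k)"
        unfolding W_def mem_Collect_eq by blast
      have "x \<in> Y k (n, \<tau>)" unfolding Y_def using x dense by simp
      then have "x \<in> Y (max k n) (n, \<tau>)" using Y_mono[of k "max k n"] by auto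
      moreover have "(n, \<tau>) \<in> I (max k n)" using \<tau> unfolding I_def by simp
      ultimately show "x \<in> (\<Union>q. G q)" unfolding G_def by blast
    qed
  qed (use G_sub in auto)
  have cov: "\<exists>K'\<ge>1. \<exists>\<^sub>F N in sequentially. covers_by d (2 / 2 ^ N) (G q) (K' * 2 powr (u * real N))" for q
  proof -
    \<comment> \<open>The factors stem from close words in one covering set, the restriction to a
      cylinder of level at most \<open>q\<close>, the \<open>q + 1\<close> pieces forming
      \<open>F q\<close>, and the deficit \<open>K\<close> of free positions, in this order.\<close>
    define c where "c = 5 ^ m * (2 ^ (m * q)) * (real q + 1) * 2 powr (real m * K)"
    define K' where "K' = 1 + real (card (I q)) * c"
    have c0: "0 \<le> c" unfolding c_def by auto
    have ev: "\<forall>\<^sub>F N in sequentially. \<forall>i\<in>{..q}. covers_by (max_metric d (eucl m)) (1 / 2 ^ N) (Es i) (2 powr (t * real N))"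
      using Es by (intro eventually_ball_finite) auto
    have "\<exists>\<^sub>F N in sequentially. (\<alpha> * real N - K \<le> real (card (A \<inter> {..<N}))) \<and> (q \<le> N \<and>
        (\<forall>i\<in>{..q}. covers_by (max_metric d (eucl m)) (1 / 2 ^ N) (Es i) (2 powr (t * real N))))"
      using frequently_eventually_conj[OF dens eventually_conj[OF eventually_ge_at_top[of q] ev]]
      by (simp add: conj_ac)
    then have "\<exists>\<^sub>F N in sequentially. covers_by d (2 / 2 ^ N) (G q) (K' * 2 powr (u * real N))"
    proof (rule frequently_elim1, elim conjE)
      fix N assume N: "\<alpha> * real N - K \<le> real (card (A \<inter> {..<N}))" "q \<le> N"
        "\<forall>i\<in>{..q}. covers_by (max_metric d (eucl m)) (1 / 2 ^ N) (Es i) (2 powr (t * real N))"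
      define a where "a = card (A \<inter> {..<N})"
      have "covers_by (max_metric d (eucl m)) (1 / 2 ^ N) (F q) (\<Sum>i\<in>{..q}. 2 powr (t * real N))"
        unfolding F_def using N(3) by (intro covers_by_UN) auto
      then have covF: "covers_by (max_metric d (eucl m)) (1 / 2 ^ N) (F q) ((real q + 1) * 2 powr (t * real N))"
        by (simp add: add.commute)
      have "covers_by d (2 * (1 / 2 ^ N)) (Y q p) (c * 2 powr (u * real N))" if p: "p \<in> I q" for p
      proof (rule covers_by_if_separated_bounded[OF assms(1)])
        fix S assume S: "finite S" "S \<subseteq> Y q p" "\<And>x y. x \<in> S \<Longrightarrow> y \<in> S \<Longrightarrow> x \<noteq> y \<Longrightarrow> 1 / 2 ^ N < d x y"
        obtain n \<tau> where p': "p = (n, \<tau>)" "n \<le> q" "\<tau> \<subseteq> {..<m} \<times> (A \<inter> {..<n})"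
          using p unfolding I_def W_def by auto
        define T where "T = {\<rho> \<in> Pow ({..<m} \<times> (A \<inter> {..<N})). trunc n \<rho> = \<tau>}"
        have "real (card S * card T) \<le> 5 ^ m * ((real q + 1) * 2 powr (t * real N))"
        proof (rule card_separated_cylinder_le[OF covF S(1,3)])
          show "finite T" unfolding T_def by auto
          fix x \<rho> assume x: "x \<in> S" and \<rho>: "\<rho> \<in> T"
          have "x \<in> Y q (n, \<tau>)" using S(2) p'(1) x by blast
          then have "n \<le> N \<longrightarrow> (\<forall>\<rho>\<in>W N. trunc n \<rho> = \<tau> \<longrightarrow>
              (\<exists>\<sigma>\<subseteq>{..<m} \<times> A. trunc N \<sigma> = \<rho> \<and> (x, binary_point \<sigma>) \<in> F q))"
            unfolding Y_def mem_Collect_eq fst_conv snd_conv by iprover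
          moreover have "n \<le> N" using p'(2) N(2) by simp
          moreover have "\<rho> \<in> W N" "trunc n \<rho> = \<tau>" using \<rho> unfolding T_def W_def by simp_all
          ultimately show "\<exists>\<sigma>\<subseteq>{..<m} \<times> A. trunc N \<sigma> = \<rho> \<and> (x, binary_point \<sigma>) \<in> F q"
            by (simp only: simp_thms)
        qed
        moreover have "2 ^ (m * a) \<le> 2 ^ (m * n) * card T"
          unfolding a_def T_def using p' N(2) by (intro card_cylinder_extensions) auto
        then have "real (2 ^ (m * a)) \<le> real (2 ^ (m * n) * card T)" by (rule of_nat_mono)
        then have "2 ^ (m * a) \<le> 2 ^ (m * n) * real (card T)" by simp
        moreover have "(2::real) ^ (m * n) \<le> 2 ^ (m * q)" using p'(2) by (intro power_increasing) auto
        ultimately have "real (card S) * 2 ^ (m * a) \<le> 2 ^ (m * q) * (5 ^ m * ((real q + 1) * 2 powr (t * real N)))"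
        proof -
          assume h: "real (card S * card T) \<le> 5 ^ m * ((real q + 1) * 2 powr (t * real N))"
            "2 ^ (m * a) \<le> 2 ^ (m * n) * real (card T)" "(2::real) ^ (m * n) \<le> 2 ^ (m * q)"
          have "real (card S) * 2 ^ (m * a) \<le> real (card S) * (2 ^ (m * n) * real (card T))"
            using h(2) by (intro mult_left_mono) auto
          also have "\<dots> = 2 ^ (m * n) * real (card S * card T)" by simp
          also have "\<dots> \<le> 2 ^ (m * q) * (5 ^ m * ((real q + 1) * 2 powr (t * real N)))"
            using h(1,3) by (intro mult_mono) auto
          finally show ?thesis .
        qed
        moreover have "2 powr (real m * (\<alpha> * real N - K)) \<le> 2 ^ (m * a)"
        proof -
          have "2 powr (real m * (\<alpha> * real N - K)) \<le> 2 powr (real m * real a)"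
            using N(1) unfolding a_def by (intro powr_mono mult_left_mono) auto
          also have "\<dots> = 2 ^ (m * a)" by (simp flip: powr_realpow)
          finally show ?thesis .
        qed
        ultimately have "real (card S) * 2 powr (real m * (\<alpha> * real N - K))
            \<le> 2 ^ (m * q) * (5 ^ m * ((real q + 1) * 2 powr (t * real N)))"
          by (meson mult_left_mono of_nat_0_le_iff order_trans)
        then have "real (card S) \<le> 2 ^ (m * q) * (5 ^ m * ((real q + 1) * 2 powr (t * real N))) / 2 powr (real m * (\<alpha> * real N - K))"
          by (simp add: pos_le_divide_eq)
        also have "\<dots> = 5 ^ m * 2 ^ (m * q) * (real q + 1) * (2 powr (t * real N) / 2 powr (real m * (\<alpha> * real N - K)))"
          by simp
        also have "2 powr (t * real N) / 2 powr (real m * (\<alpha> * real N - K)) = 2 powr (real m * K) * 2 powr (u * real N)"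
          unfolding u_def powr_diff[symmetric] powr_add[symmetric] by (simp add: algebra_simps)
        finally show "real (card S) \<le> c * 2 powr (u * real N)"
          unfolding c_def by (simp add: mult_ac)
      qed (auto simp: Y_def)
      then have "covers_by d (2 / 2 ^ N) (G q) (\<Sum>p\<in>I q. c * 2 powr (u * real N))"
        unfolding G_def using finI by (intro covers_by_UN) auto
      then show "covers_by d (2 / 2 ^ N) (G q) (K' * 2 powr (u * real N))"
        by (rule covers_by_mono) (auto simp: K'_def algebra_simps)
    qed
    moreover have "1 \<le> K'" unfolding K'_def using c0 by simp
    ultimately show ?thesis by blast
  qed
  \<comment> \<open>For negative \<open>u\<close> the covering bounds of a nonempty
    \<open>G q\<close> would drop below 1.\<close>
  have "0 \<le> u"
  proof (rule ccontr)
    assume "\<not> 0 \<le> u"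
    obtain x where "x \<in> X" using assms(2) by blast
    then obtain q where q: "x \<in> G q" using G_Un by blast
    obtain K' where K': "1 \<le> K'" "\<exists>\<^sub>F N in sequentially. covers_by d (2 / 2 ^ N) (G q) (K' * 2 powr (u * real N))"
      using cov by blast
    have "u < 0" using \<open>\<not> 0 \<le> u\<close> by simp
    then have "(2::real) powr u < 1" using powr_less_mono[of u 0 "2::real"] by simp
    then have "(\<lambda>N. K' * (2 powr u) ^ N) \<longlonglongrightarrow> 0"
      by (intro tendsto_mult_right_zero LIMSEQ_realpow_zero) auto
    then have "((\<lambda>N. K' * 2 powr (u * real N)) \<longlongrightarrow> 0) sequentially"
      by (simp add: powr_powr flip: powr_realpow)
    then have "\<forall>\<^sub>F N in sequentially. K' * 2 powr (u * real N) < 1"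
      by (rule order_tendstoD(2)) simp
    then have "\<exists>N. covers_by d (2 / 2 ^ N) (G q) (K' * 2 powr (u * real N)) \<and> K' * 2 powr (u * real N) < 1"
      using frequently_ex[OF frequently_eventually_conj[OF K'(2)]] by (simp add: conj_ac)
    then show False using covers_by_ge_1 q by fastforce
  qed
  have "lower_box_dim X d (G q) \<le> ereal u" for q
  proof -
    obtain K' where K': "1 \<le> K'" "\<exists>\<^sub>F N in sequentially. covers_by d (2 / 2 ^ N) (G q) (K' * 2 powr (u * real N))"
      using cov by blast
    show ?thesis by (rule lower_box_dim_le[OF K'(2) _ K'(1) \<open>0 \<le> u\<close> G_sub]) simp
  qed
  then have "inc_packing_dim X d X \<le> ereal u"
    unfolding inc_packing_dim_def using \<open>incseq G\<close> G_Un
    by (intro Inf_lower2[of "SUP n. lower_box_dim X d (G n)"] SUP_least) auto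
  then show ?thesis unfolding u_def .
qed

section \<open>The upper bound for products\<close>

lemma covers_by_refine:
  assumes cov: "covers_by d \<delta> E M"
    and ref: "\<And>F. F \<subseteq> E \<Longrightarrow> \<forall>x\<in>F. \<forall>y\<in>F. d x y \<le> \<delta> \<Longrightarrow> covers_by d \<delta>' F M'"
    and "0 \<le> M'"
  shows "covers_by d \<delta>' E (M * M')"
proof -
  obtain C where C: "finite C" "\<forall>F\<in>C. \<forall>x\<in>F. \<forall>y\<in>F. d x y \<le> \<delta>" "E \<subseteq> \<Union>C" "real (card C) \<le> M"
    using cov unfolding covers_by_def by blast
  have "covers_by d \<delta>' (\<Union>F\<in>C. E \<inter> F) (\<Sum>F\<in>C. M')"
    using C by (intro covers_by_UN ref) auto
  moreover have "E \<subseteq> (\<Union>F\<in>C. E \<inter> F)" using C(3) by blast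
  moreover have "(\<Sum>F\<in>C. M') \<le> M * M'" using C(4) assms(3) by (simp add: mult_right_mono)
  ultimately show ?thesis using covers_by_mono by blast
qed

text \<open>The digits are placed so that the product of the covering numbers of \<open>X\<close> and of the
  digit set stays below \<open>2 powr (m * N)\<close>: from a good scale \<open>l \<le> N\<close> on, the Assouad
  dimension bounds the growth for \<open>X\<close> while the digit set does not grow; ahead of a good scale
  \<open>l \<ge> N\<close>, the bound at \<open>l\<close> applies to \<open>X\<close> while the digit set grows at full rate.\<close>

lemma complementary_digit_set:
  fixes X :: "'a set" and m :: nat
  assumes X: "Metric_space X d" "sigma_assouad_dim X d \<le> ereal (real m)"
    and \<sigma>: "inc_packing_dim X d X < ereal \<sigma> \<or> \<sigma> = real m" "0 \<le> \<sigma>" "\<sigma> \<le> real m"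
    and \<alpha>_def: "\<alpha> = (real m - \<sigma>) / real m"
  obtains A where "\<forall>n. real (card (A \<inter> {..<n})) \<le> \<alpha> * real n"
    "\<exists>\<^sub>F n in sequentially. \<alpha> * real n - 1 \<le> real (card (A \<inter> {..<n}))"
    "\<forall>t>real m. \<exists>\<E>. countable \<E> \<and> X \<times> digit_set m A \<subseteq> \<Union>\<E> \<and> (\<forall>E\<in>\<E>. \<exists>K\<ge>1. \<forall>N.
       covers_by (max_metric d (eucl m)) ((real m + 2) / 2 ^ N) E (K * 2 powr (t * real N)))"
proof -
  \<comment> \<open>This includes \<open>m = 0\<close>: then \<open>\<sigma> = 0\<close>, and
    division by zero yields \<open>\<alpha> = 0\<close>.\<close>
  have \<alpha>: "0 \<le> \<alpha>" "\<alpha> \<le> 1" and m\<alpha>: "real m * \<alpha> = real m - \<sigma>"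
    using \<sigma>(2,3) unfolding \<alpha>_def by (auto simp: divide_le_eq)
  have "\<exists>(E :: nat \<Rightarrow> 'a set) L. (\<Union>n. E n) = X \<and> 0 \<in> L \<and> (\<alpha> = 0 \<or> infinite L) \<and>
    (\<forall>n. \<exists>K\<ge>1. \<forall>l\<in>L. covers_by d (1 / 2 ^ l) (E n) (K * 2 powr (\<sigma> * real l)))"
  proof (cases "inc_packing_dim X d X < ereal \<sigma>")
    case True
    obtain E :: "nat \<Rightarrow> 'a set" and L where "(\<Union>n. E n) = X" "0 \<in> L" "infinite L"
      "\<And>n. \<exists>K\<ge>1. \<forall>l\<in>L. covers_by d (1 / 2 ^ l) (E n) (K * 2 powr (\<sigma> * real l))"
      using inc_packing_dim_less_scales[OF True \<sigma>(2)] by metis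
    then show ?thesis by blast
  next
    \<comment> \<open>Now \<open>\<sigma> = m\<close> and \<open>\<alpha> = 0\<close>, so no digit
      will be free and scale 0 is the only one required. The sets come from the exponent
      \<open>\<sigma> + 1\<close>, which makes no difference at \<open>l = 0\<close>.\<close>
    case False
    then have "\<sigma> = real m" using \<sigma>(1) by blast
    then have "\<alpha> = 0" unfolding \<alpha>_def by simp
    have "inc_packing_dim X d X \<le> ereal \<sigma>"
      using inc_packing_dim_le_sigma_assouad_dim[OF X] \<open>\<sigma> = real m\<close> by simp
    then have less: "inc_packing_dim X d X < ereal (\<sigma> + 1)" by (rule le_less_trans) simp
    have "0 \<le> \<sigma> + 1" using \<sigma>(2) by simp
    then obtain E :: "nat \<Rightarrow> 'a set" and L where EL: "(\<Union>n. E n) = X" "0 \<in> L" "infinite L"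
      "\<And>n. \<exists>K\<ge>1. \<forall>l\<in>L. covers_by d (1 / 2 ^ l) (E n) (K * 2 powr ((\<sigma> + 1) * real l))"
      using inc_packing_dim_less_scales[OF less] by metis
    have "\<exists>K\<ge>1. \<forall>l\<in>{0}. covers_by d (1 / 2 ^ l) (E n) (K * 2 powr (\<sigma> * real l))" for n
      using EL(4)[of n] EL(2) by force
    then show ?thesis using EL(1) \<open>\<alpha> = 0\<close> by (intro exI[of _ E] exI[of _ "{0}"]) blast
  qed
  then obtain E :: "nat \<Rightarrow> 'a set" and L where E: "(\<Union>n. E n) = X" and L: "0 \<in> L" "\<alpha> = 0 \<or> infinite L"
    and EL: "\<And>n. \<exists>K\<ge>1. \<forall>l\<in>L. covers_by d (1 / 2 ^ l) (E n) (K * 2 powr (\<sigma> * real l))" by blast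
  obtain A where A: "\<And>n. real (card (A \<inter> {..<n})) \<le> \<alpha> * real n"
    "\<And>l. l \<in> L \<Longrightarrow> \<alpha> * real l - 1 \<le> real (card (A \<inter> {..<l}))"
    "\<And>n. \<exists>l\<in>L. l \<le> n \<and> real (card (A \<inter> {..<n})) \<le> \<alpha> * real l \<or>
       n \<le> l \<and> real (card (A \<inter> {..<n})) \<le> \<alpha> * real l - (real l - real n)"
    using digit_positions_exist[OF L(1) \<alpha>] by metis
  show ?thesis
  proof (rule that[of A])
    show "\<forall>n. real (card (A \<inter> {..<n})) \<le> \<alpha> * real n" using A(1) by blast
    show "\<exists>\<^sub>F n in sequentially. \<alpha> * real n - 1 \<le> real (card (A \<inter> {..<n}))"
    proof (cases "\<alpha> = 0")
      case True
      then have "\<alpha> * real n - 1 \<le> real (card (A \<inter> {..<n}))" for n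
        using of_nat_0_le_iff[of "card (A \<inter> {..<n})", where 'a=real] by simp
      then show ?thesis by (simp add: frequently_const)
    next
      case False
      then have "infinite L" using L(2) by blast
      then have "\<exists>\<^sub>F n in sequentially. n \<in> L"
        unfolding frequently_sequentially infinite_nat_iff_unbounded_le by blast
      then show ?thesis by (rule frequently_elim1) (rule A(2))
    qed
    show "\<forall>t>real m. \<exists>\<E>. countable \<E> \<and> X \<times> digit_set m A \<subseteq> \<Union>\<E> \<and> (\<forall>E\<in>\<E>. \<exists>K\<ge>1. \<forall>N.
       covers_by (max_metric d (eucl m)) ((real m + 2) / 2 ^ N) E (K * 2 powr (t * real N)))"
    proof (intro allI impI)
      fix t assume t: "real m < t"
      have sig: "sigma_assouad_dim X d < ereal t" using X(2) t by (simp add: le_less_trans)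
      obtain Xs :: "nat \<Rightarrow> 'a set" and Q :: "nat \<Rightarrow> real" where Xs: "X = (\<Union>i. Xs i)" "\<And>i. 1 \<le> Q i"
        "\<And>i. \<forall>F\<subseteq>Xs i. \<forall>D r. (\<forall>x\<in>F. \<forall>y\<in>F. d x y \<le> D) \<longrightarrow> 0 < r \<longrightarrow> r \<le> D
           \<longrightarrow> covers_by d (2 * r) F (Q i * (D / r) powr t)"
        using sigma_assouad_pieces[OF X(1) sig] by metis
      \<comment> \<open>\<open>E k\<close> supplies the bounds at good scales, \<open>Xs i\<close>
        the control of growth at finer ones.\<close>
      define P where "P p = (E (fst p) \<inter> Xs (snd p)) \<times> digit_set m A" for p
      have cov: "\<exists>K\<ge>1. \<forall>N. covers_by (max_metric d (eucl m)) ((real m + 2) / 2 ^ N) (P (k, i)) (K * 2 powr (t * real N))" for k i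
      proof -
        obtain K where K: "1 \<le> K" "\<forall>l\<in>L. covers_by d (1 / 2 ^ l) (E k) (K * 2 powr (\<sigma> * real l))"
          using EL by blast
        have KQ: "1 \<le> K * Q i" using K(1) Xs(2)[of i] mult_mono[of 1 K 1 "Q i"] by simp
        have "covers_by (max_metric d (eucl m)) ((real m + 2) / 2 ^ N) (P (k, i)) ((K * Q i) * 2 powr (t * real N))" for N
        proof -
          define a where "a = card (A \<inter> {..<N})"
          obtain l where l: "l \<in> L" "l \<le> N \<and> real a \<le> \<alpha> * real l \<or> N \<le> l \<and> real a \<le> \<alpha> * real l - (real l - real N)"
            using A(3)[of N] unfolding a_def by blast
          have covl: "covers_by d (1 / 2 ^ l) (E k \<inter> Xs i) (K * 2 powr (\<sigma> * real l))"
            using covers_by_mono[OF K(2)[rule_format, OF l(1)]] by auto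
          \<comment> \<open>The factor \<open>m + 2\<close> leaves room both for the diameter
            \<open>m / 2 ^ N\<close> of cylinders and for the diameter \<open>2 / 2 ^ N\<close> of
            the refined pieces of \<open>X\<close>.\<close>
          have covZ: "covers_by (eucl m) ((real m + 2) / 2 ^ N) (digit_set m A) (2 powr (real m * real a))"
            using covers_by_mono[OF covers_by_digit_set[of m N A], of "(real m + 2) / 2 ^ N" "2 powr (real m * real a)"]
            by (simp add: a_def divide_right_mono flip: powr_realpow)
          have "\<exists>e. covers_by d ((real m + 2) / 2 ^ N) (E k \<inter> Xs i) (K * Q i * 2 powr e) \<and> e + real m * real a \<le> t * real N"
            using l(2)
          proof
            assume le: "l \<le> N \<and> real a \<le> \<alpha> * real l"
            have "(2::real) ^ l \<le> 2 ^ N" using le by (intro power_increasing) auto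
            then have r: "(1 / 2 ^ N :: real) \<le> 1 / 2 ^ l" by (simp add: frac_le)
            have pw: "((1 / 2 ^ l) / (1 / 2 ^ N)) powr t = 2 powr (t * (real N - real l))"
            proof -
              have "(1 / 2 ^ l) / (1 / 2 ^ N) = (2::real) powr (real N - real l)"
                by (simp add: powr_diff powr_realpow)
              then show ?thesis by (simp add: powr_powr mult.commute)
            qed
            \<comment> \<open>Pieces of diameter \<open>1 / 2 ^ l\<close> are subdivided by
              homogeneity. As \<open>m a \<le> (m - \<sigma>) l\<close>, the exponents add up to at
              most \<open>m l + t (N - l) \<le> t N\<close>.\<close>
            have "covers_by d (2 * (1 / 2 ^ N)) (E k \<inter> Xs i) (K * 2 powr (\<sigma> * real l) * (Q i * 2 powr (t * (real N - real l))))"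
            proof (rule covers_by_refine[OF covl])
              fix F assume F: "F \<subseteq> E k \<inter> Xs i" "\<forall>x\<in>F. \<forall>y\<in>F. d x y \<le> 1 / 2 ^ l"
              then have "covers_by d (2 * (1 / 2 ^ N)) F (Q i * ((1 / 2 ^ l) / (1 / 2 ^ N)) powr t)"
                using Xs(3)[rule_format, of F i "1 / 2 ^ l" "1 / 2 ^ N"] r by simp
              then show "covers_by d (2 * (1 / 2 ^ N)) F (Q i * 2 powr (t * (real N - real l)))"
                unfolding pw .
            qed (use Xs(2)[of i] in auto)
            also have "K * 2 powr (\<sigma> * real l) * (Q i * 2 powr (t * (real N - real l)))
                = K * Q i * 2 powr (\<sigma> * real l + t * (real N - real l))"
              by (simp add: powr_add)
            finally have "covers_by d ((real m + 2) / 2 ^ N) (E k \<inter> Xs i) (K * Q i * 2 powr (\<sigma> * real l + t * (real N - real l)))"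
              by (rule covers_by_mono) (auto simp: divide_right_mono)
            moreover have "real m * real a \<le> (real m * \<alpha>) * real l"
              using le by (simp add: mult.assoc mult_left_mono)
            then have "\<sigma> * real l + t * (real N - real l) + real m * real a \<le> real m * real l + t * (real N - real l)"
              unfolding m\<alpha> by (simp add: algebra_simps)
            moreover have "real m * real l \<le> t * real l" using t by (intro mult_right_mono) auto
            ultimately show ?thesis
              by (intro exI[of _ "\<sigma> * real l + t * (real N - real l)"]) (auto simp: algebra_simps)
          next
            assume ge: "N \<le> l \<and> real a \<le> \<alpha> * real l - (real l - real N)"
            have "(2::real) ^ N \<le> 2 ^ l" using ge by (intro power_increasing) auto
            then have "(1 / 2 ^ l :: real) \<le> 1 / 2 ^ N" by (simp add: frac_le)
            also have "\<dots> \<le> (real m + 2) / 2 ^ N" by (simp add: divide_right_mono)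
            finally have "(1 / 2 ^ l :: real) \<le> (real m + 2) / 2 ^ N" .
            moreover have "K * 2 powr (\<sigma> * real l) \<le> K * Q i * 2 powr (\<sigma> * real l)"
              using K(1) Xs(2)[of i] by simp
            ultimately have "covers_by d ((real m + 2) / 2 ^ N) (E k \<inter> Xs i) (K * Q i * 2 powr (\<sigma> * real l))"
              using covers_by_mono[OF covl] by blast
            \<comment> \<open>The missing \<open>l - N\<close> positions in each coordinate make up
              for using the finer scale \<open>l\<close>:
              \<open>\<sigma> l + (m - \<sigma>) l - m (l - N) = m N\<close>.\<close>
            moreover have "real m * real a \<le> real m * (\<alpha> * real l - (real l - real N))"
              using ge by (intro mult_left_mono) auto
            then have "real m * real a \<le> (real m * \<alpha>) * real l - real m * (real l - real N)"
              by (simp add: algebra_simps)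
            then have "\<sigma> * real l + real m * real a \<le> real m * real N"
              unfolding m\<alpha> by (simp add: algebra_simps)
            moreover have "real m * real N \<le> t * real N" using t by (intro mult_right_mono) auto
            ultimately show ?thesis by (intro exI[of _ "\<sigma> * real l"]) auto
          qed
          then obtain e where e: "covers_by d ((real m + 2) / 2 ^ N) (E k \<inter> Xs i) (K * Q i * 2 powr e)"
            "e + real m * real a \<le> t * real N" by blast
          have "covers_by (max_metric d (eucl m)) ((real m + 2) / 2 ^ N) (P (k, i)) (K * Q i * 2 powr e * 2 powr (real m * real a))"
            unfolding P_def using covers_by_Times[OF e(1) covZ] by simp
          moreover have "K * Q i * 2 powr e * 2 powr (real m * real a) \<le> K * Q i * 2 powr (t * real N)"
          proof -
            have "2 powr e * 2 powr (real m * real a) \<le> 2 powr (t * real N)"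
              using e(2) by (simp flip: powr_add)
            then have "K * Q i * (2 powr e * 2 powr (real m * real a)) \<le> K * Q i * 2 powr (t * real N)"
              using KQ by (intro mult_left_mono) auto
            then show ?thesis by (simp only: mult.assoc)
          qed
          ultimately show ?thesis using covers_by_mono by blast
        qed
        then show ?thesis using KQ by blast
      qed
      have "X \<times> digit_set m A \<subseteq> \<Union>(range P)"
      proof
        fix z assume "z \<in> X \<times> digit_set m A"
        then obtain x y where z: "z = (x, y)" "x \<in> X" "y \<in> digit_set m A" by blast
        moreover obtain k where "x \<in> E k" using E z by blast
        moreover obtain i where "x \<in> Xs i" using Xs(1) z by blast
        ultimately have "z \<in> P (k, i)" unfolding P_def by simp
        then show "z \<in> \<Union>(range P)" by blast
      qed
      moreover have "\<forall>F\<in>range P. \<exists>K\<ge>1. \<forall>N.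
          covers_by (max_metric d (eucl m)) ((real m + 2) / 2 ^ N) F (K * 2 powr (t * real N))"
        using cov by auto
      ultimately show "\<exists>\<E>. countable \<E> \<and> X \<times> digit_set m A \<subseteq> \<Union>\<E> \<and> (\<forall>E\<in>\<E>. \<exists>K\<ge>1. \<forall>N.
         covers_by (max_metric d (eucl m)) ((real m + 2) / 2 ^ N) E (K * 2 powr (t * real N)))"
        by (intro exI[of _ "range P"]) auto
    qed
  qed
qed

section \<open>The compact set and the dimension of its product with the space\<close>

lemma packing_dim_nonneg: "0 \<le> packing_dim X d E"
  unfolding packing_dim_def
  by (rule Inf_greatest) (auto intro: SUP_upper2 upper_box_dim_nonneg)

lemma packing_dim_empty: "packing_dim X d {} = 0"
  using packing_dim_le[of "{}" X "{}" d 0] packing_dim_nonneg[of X d "{}"] by auto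

lemma inc_packing_dim_empty: "inc_packing_dim X d {} = 0"
proof -
  have "covers_by d \<delta> {} 1" for \<delta> unfolding covers_by_def by (intro exI[of _ "{}"]) simp
  then have "lower_box_dim X d {} \<le> ereal 0"
    by (intro lower_box_dim_le[where c=1 and K=1]) auto
  then have "inc_packing_dim X d {} \<le> 0" unfolding inc_packing_dim_def
    by (intro Inf_lower2[of "SUP n::nat. lower_box_dim X d {}"]) (auto simp: zero_ereal_def intro!: exI[of _ "\<lambda>_. {}"])
  then show ?thesis using inc_packing_dim_nonneg[of X d "{}"] by order
qed

lemma le_if_le_divide_Suc:
  fixes a b c :: real
  assumes "\<And>j. a \<le> b + c / real (Suc j)"
  shows "a \<le> b"
proof (rule LIMSEQ_le_const)
  show "(\<lambda>j. b + c / real (Suc j)) \<longlonglongrightarrow> b" by real_asymp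
qed (use assms in blast)

theorem theorem5p5:
  fixes X :: "'a set" and d :: "'a \<Rightarrow> 'a \<Rightarrow> real" and m :: nat
  assumes "Metric_space X d"
    and "sigma_assouad_dim X d \<le> ereal (real m)"
  shows "\<exists>Z. Z \<subseteq> Rm m \<and> compactin (Metric_space.mtopology (Rm m) (eucl m)) Z \<and>
           packing_dim (X \<times> Z) (max_metric d (eucl m)) (X \<times> Z)
             = inc_packing_dim X d X + packing_dim (Rm m) (eucl m) Z"
proof (cases "X = {}")
  case True
  \<comment> \<open>The lower bounds use a point of \<open>X\<close>; for empty \<open>X\<close> the
    empty \<open>Z\<close> gives \<open>0 = 0 + 0\<close>.\<close>
  then show ?thesis by (intro exI[of _ "{}"]) (simp add: packing_dim_empty inc_packing_dim_empty)
next
  case False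
  interpret Metric_space X d by fact
  let ?D = "max_metric d (eucl m)"
  have "inc_packing_dim X d X \<le> ereal (real m)"
    by (rule inc_packing_dim_le_sigma_assouad_dim[OF assms]) simp
  then obtain s where s: "inc_packing_dim X d X = ereal s" "0 \<le> s" "s \<le> real m"
    using inc_packing_dim_nonneg[of X d X] by (cases "inc_packing_dim X d X") auto
  \<comment> \<open>The exponents start at \<open>m\<close> and tend to \<open>s\<close>. For
    \<open>s < m\<close> they stay above \<open>s\<close>, so that good scales exist; for
    \<open>s = m\<close> they all equal \<open>m\<close>.\<close>
  define \<sigma> \<alpha> where "\<sigma> j = s + (real m - s) / real (Suc j)" and "\<alpha> j = (real m - \<sigma> j) / real m" for j
  have frac: "0 \<le> (real m - s) / real (Suc j)" "(real m - s) / real (Suc j) \<le> real m - s" for j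
    using s(3) mult_right_mono[of 1 "real (Suc j)" "real m - s"] by (auto simp: divide_le_eq mult.commute)
  have \<sigma>_bounds: "0 \<le> \<sigma> j" "s \<le> \<sigma> j" "\<sigma> j \<le> real m" for j
    using frac[of j] s(2) unfolding \<sigma>_def by linarith+
  have m\<alpha>: "real m * \<alpha> j = real m - \<sigma> j" for j
    using \<sigma>_bounds[of j] unfolding \<alpha>_def by auto
  have \<sigma>_cases: "inc_packing_dim X d X < ereal (\<sigma> j) \<or> \<sigma> j = real m" for j
  proof (cases "s < real m")
    case True
    then have "0 < (real m - s) / real (Suc j)" by simp
    then show ?thesis unfolding \<sigma>_def s(1) by simp
  next
    case False
    then show ?thesis using s(3) unfolding \<sigma>_def by simp
  qed
  define fits where "fits j B \<longleftrightarrow> (\<forall>n. real (card (B \<inter> {..<n})) \<le> \<alpha> j * real n) \<and>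
    (\<exists>\<^sub>F n in sequentially. \<alpha> j * real n - 1 \<le> real (card (B \<inter> {..<n}))) \<and>
    (\<forall>t>real m. \<exists>\<E>. countable \<E> \<and> X \<times> digit_set m B \<subseteq> \<Union>\<E> \<and> (\<forall>E\<in>\<E>. \<exists>K\<ge>1. \<forall>N.
       covers_by ?D ((real m + 2) / 2 ^ N) E (K * 2 powr (t * real N))))" for j B
  have "\<exists>B. fits j B" for j
    unfolding fits_def
    by (rule complementary_digit_set[OF assms \<sigma>_cases \<sigma>_bounds(1,3) \<alpha>_def]) blast
  then obtain A where fits: "\<And>j. fits j (A j)" by metis
  have A: "\<And>j n. real (card (A j \<inter> {..<n})) \<le> \<alpha> j * real n"
    "\<And>j. \<exists>\<^sub>F n in sequentially. \<alpha> j * real n - 1 \<le> real (card (A j \<inter> {..<n}))"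
    using fits unfolding fits_def by simp_all
  \<comment> \<open>Dropping the positions below \<open>j\<close> moves \<open>Y j\<close> towards
    the origin, which makes the union compact, and loses at most \<open>j\<close> free
    positions.\<close>
  define Y where "Y j = digit_set m (A j \<inter> {j..})" for j
  define Z where "Z = (\<Union>j. Y j)"
  have Y_Rm: "Y j \<subseteq> Rm m" for j unfolding Y_def by (rule digit_set_subset_Rm)
  have dens: "\<exists>\<^sub>F n in sequentially. \<alpha> j * real n - (real j + 1) \<le> real (card (A j \<inter> {j..} \<inter> {..<n}))" for j
    using A(2)[of j]
  proof (rule frequently_elim1)
    fix n assume n: "\<alpha> j * real n - 1 \<le> real (card (A j \<inter> {..<n}))"
    have "card (A j \<inter> {..<n}) \<le> card ({..<j} \<union> (A j \<inter> {j..} \<inter> {..<n}))" by (intro card_mono) auto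
    also have "\<dots> \<le> j + card (A j \<inter> {j..} \<inter> {..<n})" using card_Un_le[of "{..<j}"] by simp
    finally show "\<alpha> j * real n - (real j + 1) \<le> real (card (A j \<inter> {j..} \<inter> {..<n}))" using n by linarith
  qed
  have upper: "packing_dim (X \<times> Z) ?D (X \<times> Z) \<le> ereal t" if t: "real m < t" for t
  proof -
    define admissible where "admissible j \<E> \<longleftrightarrow> countable \<E> \<and> X \<times> digit_set m (A j) \<subseteq> \<Union>\<E> \<and>
      (\<forall>E\<in>\<E>. \<exists>K\<ge>1. \<forall>N. covers_by ?D ((real m + 2) / 2 ^ N) E (K * 2 powr (t * real N)))" for j \<E>
    have "\<exists>\<E>. admissible j \<E>" for j
      using fits[of j] t unfolding fits_def admissible_def by simp
    then obtain \<E> where "\<And>j. admissible j (\<E> j)" by metis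
    then have \<E>: "\<And>j. countable (\<E> j)" "\<And>j. X \<times> digit_set m (A j) \<subseteq> \<Union>(\<E> j)"
      "\<And>j. \<forall>E\<in>\<E> j. \<exists>K\<ge>1. \<forall>N. covers_by ?D ((real m + 2) / 2 ^ N) E (K * 2 powr (t * real N))"
      unfolding admissible_def by simp_all
    have sub: "X \<times> Y j \<subseteq> \<Union>(\<E> j)" for j
    proof -
      have "Y j \<subseteq> digit_set m (A j)" unfolding Y_def by (rule digit_set_mono) simp
      then show ?thesis using \<E>(2)[of j] by blast
    qed
    show ?thesis
    proof (rule packing_dim_le)
      \<comment> \<open>The covering sets may reach outside \<open>X \<times> Z\<close>, the ambient
        space of the dimension, and are cut down to it.\<close>
      let ?F = "(\<lambda>E. E \<inter> (X \<times> Z)) ` (\<Union>j. \<E> j)"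
      show "countable ?F" using \<E>(1) by auto
      show "X \<times> Z \<subseteq> \<Union>?F"
      proof
        fix z assume z: "z \<in> X \<times> Z"
        then obtain j where "z \<in> X \<times> Y j" unfolding Z_def by blast
        then obtain E where "E \<in> \<E> j" "z \<in> E" using sub by blast
        then show "z \<in> \<Union>?F" using z by blast
      qed
      fix F assume "F \<in> ?F"
      then obtain E j where E: "E \<in> \<E> j" "F = E \<inter> (X \<times> Z)" by blast
      then obtain K where K: "1 \<le> K" "\<forall>N. covers_by ?D ((real m + 2) / 2 ^ N) E (K * 2 powr (t * real N))"
        using \<E>(3) by blast
      have "covers_by ?D ((real m + 2) / 2 ^ N) F (K * 2 powr (t * real N))" for N
        using covers_by_mono[OF K(2)[rule_format, of N]] E(2) by auto
      then show "upper_box_dim (X \<times> Z) ?D F \<le> ereal t"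
        using K(1) t E(2) by (intro upper_box_dim_le[where c="real m + 2" and K=K]) auto
    qed (use t in auto)
  qed
  have lower: "real m \<le> t" if less: "packing_dim (X \<times> Z) ?D (X \<times> Z) < ereal t" for t
  proof -
    obtain Es :: "nat \<Rightarrow> ('a \<times> (nat \<Rightarrow> real)) set" where Es: "X \<times> Z \<subseteq> (\<Union>n. Es n)"
      "\<forall>n. \<forall>\<^sub>F N in sequentially. covers_by ?D (1 / 2 ^ N) (Es n) (2 powr (t * real N))"
      using packing_dim_less_cover[OF less] by (elim exE conjE)
    \<comment> \<open>The \<open>j\<close>-th digit set yields
      \<open>s \<le> t - m + \<sigma> j\<close>, and \<open>\<sigma> j - s\<close> tends to
      0.\<close>
    have "real m \<le> t + (real m - s) / real (Suc j)" for j
    proof -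
      have "X \<times> digit_set m (A j \<inter> {j..}) \<subseteq> (\<Union>n. Es n)" using Es(1) unfolding Z_def Y_def by blast
      from inc_packing_dim_le_if_product_covered[OF assms(1) False this Es(2)[rule_format] dens]
      have "s \<le> t - real m * \<alpha> j" unfolding s(1) by simp
      then show ?thesis unfolding m\<alpha> \<sigma>_def by simp
    qed
    then show ?thesis by (rule le_if_le_divide_Suc)
  qed
  have Z_lower: "real m - s \<le> t" if less: "packing_dim (Rm m) (eucl m) Z < ereal t" for t
  proof -
    obtain Es :: "nat \<Rightarrow> (nat \<Rightarrow> real) set" where Es: "Z \<subseteq> (\<Union>n. Es n)"
      "\<forall>n. \<forall>\<^sub>F N in sequentially. covers_by (eucl m) (1 / 2 ^ N) (Es n) (2 powr (t * real N))"
      using packing_dim_less_cover[OF less] by (elim exE conjE)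
    obtain x where x: "x \<in> X" using False by blast
    \<comment> \<open>The lower bound for products is applied to a one-point space, whose increasing
      packing dimension is nonnegative; this bounds the dimension of \<open>Z\<close> itself from
      below.\<close>
    have "Metric_space {x} d" using x by (intro subspace) auto
    have cov: "\<forall>\<^sub>F N in sequentially. covers_by ?D (1 / 2 ^ N) ({x} \<times> Es n) (2 powr (t * real N))" for n
      using spec[OF Es(2), of n]
    proof (rule eventually_mono)
      fix N assume N: "covers_by (eucl m) (1 / 2 ^ N) (Es n) (2 powr (t * real N))"
      have "covers_by d (1 / 2 ^ N) {x} 1"
        unfolding covers_by_def using x by (intro exI[of _ "{{x}}"]) auto
      from covers_by_Times[OF this N] show "covers_by ?D (1 / 2 ^ N) ({x} \<times> Es n) (2 powr (t * real N))"
        by simp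
    qed
    have "real m - s \<le> t + (real m - s) / real (Suc j)" for j
    proof -
      have "{x} \<times> digit_set m (A j \<inter> {j..}) \<subseteq> (\<Union>n. {x} \<times> Es n)"
        using Es(1) unfolding Z_def Y_def by blast
      from inc_packing_dim_le_if_product_covered[OF \<open>Metric_space {x} d\<close> _ this cov dens]
      have "inc_packing_dim {x} d {x} \<le> ereal (t - real m * \<alpha> j)" by simp
      then have "0 \<le> ereal (t - real m * \<alpha> j)" using inc_packing_dim_nonneg order_trans by blast
      then show ?thesis unfolding m\<alpha> \<sigma>_def by simp
    qed
    then show ?thesis by (rule le_if_le_divide_Suc)
  qed
  have Z_upper: "packing_dim (Rm m) (eucl m) Z \<le> ereal (real m - s)"
  proof (rule packing_dim_le)
    show "countable (range Y)" "Z \<subseteq> \<Union>(range Y)" unfolding Z_def by auto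
    fix F assume "F \<in> range Y"
    then obtain j where j: "F = Y j" by blast
    then show "F \<subseteq> Rm m" using Y_Rm by simp
    \<comment> \<open>The upper bound on the number of free positions holds at every scale, and
      \<open>m \<alpha> j = m - \<sigma> j \<le> m - s\<close>.\<close>
    have "covers_by (eucl m) ((real m + 1) / 2 ^ N) F (1 * 2 powr ((real m - s) * real N))" for N
    proof -
      have "real (card (A j \<inter> {j..} \<inter> {..<N})) \<le> real (card (A j \<inter> {..<N}))"
        by (intro of_nat_mono card_mono) auto
      also have "\<dots> \<le> \<alpha> j * real N" by (rule A(1))
      finally have "real m * real (card (A j \<inter> {j..} \<inter> {..<N})) \<le> real m * (\<alpha> j * real N)"
        by (intro mult_left_mono) auto
      also have "\<dots> = (real m - \<sigma> j) * real N" by (simp only: m\<alpha> flip: mult.assoc)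
      also have "\<dots> \<le> (real m - s) * real N" using \<sigma>_bounds(2)[of j] by (intro mult_right_mono) auto
      finally have "2 powr (real m * real (card (A j \<inter> {j..} \<inter> {..<N}))) \<le> 2 powr ((real m - s) * real N)"
        by (intro powr_mono) auto
      then have "2 ^ (m * card (A j \<inter> {j..} \<inter> {..<N})) \<le> 2 powr ((real m - s) * real N)"
        by (simp flip: powr_realpow)
      then show ?thesis unfolding j Y_def
        by (intro covers_by_mono[OF covers_by_digit_set[of m N]]) (auto simp: divide_right_mono)
    qed
    then show "upper_box_dim (Rm m) (eucl m) F \<le> ereal (real m - s)"
      using s(3) Y_Rm j by (intro upper_box_dim_le[where c="real m + 1" and K=1]) auto
  qed (use s(3) in auto)
  have "packing_dim (X \<times> Z) ?D (X \<times> Z) = ereal (real m)"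
  proof (rule antisym)
    show "packing_dim (X \<times> Z) ?D (X \<times> Z) \<le> ereal (real m)"
    proof (rule ccontr)
      assume "\<not> ?thesis"
      then obtain t where "ereal (real m) < ereal t" "ereal t < packing_dim (X \<times> Z) ?D (X \<times> Z)"
        using ereal_dense2 by (meson linorder_not_le)
      then show False using upper[of t] by simp
    qed
    show "ereal (real m) \<le> packing_dim (X \<times> Z) ?D (X \<times> Z)"
    proof (rule ccontr)
      assume "\<not> ?thesis"
      then obtain t where "packing_dim (X \<times> Z) ?D (X \<times> Z) < ereal t" "ereal t < ereal (real m)"
        using ereal_dense2 by (meson linorder_not_le)
      then show False using lower by fastforce
    qed
  qed
  moreover have "packing_dim (Rm m) (eucl m) Z = ereal (real m - s)"
  proof (rule antisym[OF Z_upper], rule ccontr)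
    assume "\<not> ereal (real m - s) \<le> packing_dim (Rm m) (eucl m) Z"
    then obtain t where "packing_dim (Rm m) (eucl m) Z < ereal t" "ereal t < ereal (real m - s)"
      using ereal_dense2 by (meson linorder_not_le)
    then show False using Z_lower by fastforce
  qed
  ultimately have "packing_dim (X \<times> Z) ?D (X \<times> Z)
      = inc_packing_dim X d X + packing_dim (Rm m) (eucl m) Z" unfolding s(1) by simp
  moreover have "Z \<subseteq> Rm m" using Y_Rm unfolding Z_def by blast
  moreover have "compactin (Metric_space.mtopology (Rm m) (eucl m)) Z"
    unfolding Z_def Y_def by (rule compactin_UN_digit_sets)
  ultimately show ?thesis by blast
qed

end
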